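(* Fix $g_1^+>0$. For $f_1^+>\frac12+g_1^+$ let $A=A_{f_1^+,g_1^+}$ be the global $SU(2)^2\times U(1)$-invariant $G_2$-instanton with gauge group $SU(2)$ on the BGGG $G_2$-manifold $\mathbb{R}^4\times S^3$ extending smoothly on $P_1$, $$A=A_1f^+T_1\otimes\eta_1^++A_2g^+(T_2\otimes\eta_2^++T_3\otimes\eta_3^+),\qquad f^+=f_1^+t+O(t^3),\quad g^+=g_1^+t+O(t^3).$$ Then the map $$Hol_\infty:\left(\tfrac12+g_1^+,+\infty\right)\to U(1)\subset SU(2)$$ sending $f_1^+$ to the limit as $t\to+\infty$ of the holonomy of $A_{f_1^+,g_1^+}$ around the circle $\gamma_t$ is surjective.
   Context: Conventions: $SU(2)$ is identified with the unit quaternions; $\{T_i\}_{i=1}^3$ is a basis of $\mathfrak{su}(2)$ with $[T_i,T_j]=2\epsilon_{ijk}T_k$; $T_i^{\pm}=(T_i,\pm T_i)$; $\{\eta_i^{\pm}\}$ are the left-invariant 1-forms on $SU(2)^2$ dual to $\{T_i^{\pm}\}$. Manifold: $\mathbb{R}^4\times S^3\subset\mathbb{H}\times\mathbb{H}$ with $SU(2)^2$ acting by $(a_1,a_2)\cdot(p,q)=(a_1p,a_1q\bar a_2)$; the complement of $\{0\}\times S^3\cong SU(2)^2/\Delta SU(2)$ is identified with $\mathbb{R}^+_t\times SU(2)^2$ via $(t,a_1,a_2)\mapsto(ta_1,a_1\bar a_2)$. The extra $U(1)$ acts on $SU(2)^2$ by right multiplication by the diagonal one-parameter subgroup generated by $T_1^+$.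 BGGG structure: define $r\in[9/4,\infty)$ by $t(r)=\int_{9/4}^r\frac{\sqrt{(s-3/4)(s+3/4)}}{\sqrt{(s-9/4)(s+9/4)}}ds$ and $$A_1=\frac{\sqrt{(r-9/4)(r+9/4)}}{\sqrt{(r-3/4)(r+3/4)}},\quad A_2=A_3=\sqrt{\tfrac{(r-9/4)(r+3/4)}{3}},\quad B_1=\tfrac{2r}{3},\quad B_2=B_3=\sqrt{\tfrac{(r-3/4)(r+9/4)}{3}}.$$ With $\omega=4\sum_iA_iB_i\eta_i^-\wedge\eta_i^+$ and $\Omega_2=-8A_1A_2A_3\eta_{123}^++4\sum\epsilon_{ijk}B_iB_jA_k\eta_i^-\wedge\eta_j^-\wedge\eta_k^+$, the dual 4-form of the $G_2$-structure is $\psi=\frac12\omega^2-dt\wedge\Omega_2$; the metric is $g=dt^2+\sum_i(2A_i)^2(\eta_i^+)^2+(2B_i)^2(\eta_i^-)^2$. A $G_2$-instanton is a connection with $F_A\wedge\psi=0$. $P_1=SU(2)^2\times_{(\Delta SU(2),1)}SU(2)$ (trivial isotropy homomorphism), pulled back from $S^3$ to $\mathbb{R}^4\times S^3$. Invariant $G_2$-instantons extending smoothly on $P_1$ are, up to invariant gauge transformation, of the displayed form with $f^+,g^+$ solving $$\dot f^++\tfrac12\Big(\tfrac{A_1}{B_2^2}-\tfrac{A_1}{A_2^2}\Big)f^+=-(g^+)^2,\qquad \dot g^++\tfrac12\Big(\tfrac{A_2^2+B_1^2+B_2^2}{A_2B_1B_2}-\tfrac{A_1^2+2A_2^2}{A_1A_2^2}\Big)g^+=-f^+g^+,$$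 and are uniquely determined by $(f_1^+,g_1^+)$; those with $f_1^+\ge\frac12+g_1^+>\frac12$ are globally defined with bounded curvature. The circle is $\gamma_t(\theta)=(t,\exp_{(1,1)}(2\pi\theta T_1^+))\in\mathbb{R}^+_t\times SU(2)^2$, $\theta\in[0,1]$, and $Hol(\gamma_t)=\exp\left(\int_{\gamma_t}A\right)=\exp(2\pi A_1(t)f^+(t)T_1)\in U(1)=\{\exp(\theta T_1):\theta\in\mathbb{R}\}$. *)

theory Defs
  imports "HOL-Analysis.Analysis" "HOL-Library.Landau_Symbols"
begin

section \<open>Quaternions\<close>

datatype quat = Quat (q0: real) (q1: real) (q2: real) (q3: real)

lemma quat_eq_iff: "x = y \<longleftrightarrow> q0 x = q0 y \<and> q1 x = q1 y \<and> q2 x = q2 y \<and> q3 x = q3 y"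
  by (cases x; cases y) simp

instantiation quat :: ab_group_add
begin
definition zero_quat where "0 = Quat 0 0 0 0"
definition plus_quat where "x + y = Quat (q0 x + q0 y) (q1 x + q1 y) (q2 x + q2 y) (q3 x + q3 y)"
definition minus_quat where "x - y = Quat (q0 x - q0 y) (q1 x - q1 y) (q2 x - q2 y) (q3 x - q3 y)"
definition uminus_quat where "- x = Quat (- q0 x) (- q1 x) (- q2 x) (- q3 x)"
instance
  by intro_classes
    (simp_all add: quat_eq_iff zero_quat_def plus_quat_def minus_quat_def uminus_quat_def)
end

lemma quat_add_sel [simp]:
  "q0 (x + y) = q0 x + q0 y" "q1 (x + y) = q1 x + q1 y"
  "q2 (x + y) = q2 x + q2 y" "q3 (x + y) = q3 x + q3 y"
  "q0 (x - y) = q0 x - q0 y" "q1 (x - y) = q1 x - q1 y"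
  "q2 (x - y) = q2 x - q2 y" "q3 (x - y) = q3 x - q3 y"
  "q0 (- x) = - q0 x" "q1 (- x) = - q1 x" "q2 (- x) = - q2 x" "q3 (- x) = - q3 x"
  "q0 0 = 0" "q1 0 = 0" "q2 0 = 0" "q3 0 = 0"
  by (simp_all add: zero_quat_def plus_quat_def minus_quat_def uminus_quat_def)

instantiation quat :: ring_1
begin
definition one_quat where "1 = Quat 1 0 0 0"
definition times_quat where "x * y = Quat
  (q0 x * q0 y - q1 x * q1 y - q2 x * q2 y - q3 x * q3 y)
  (q0 x * q1 y + q1 x * q0 y + q2 x * q3 y - q3 x * q2 y)
  (q0 x * q2 y - q1 x * q3 y + q2 x * q0 y + q3 x * q1 y)
  (q0 x * q3 y + q1 x * q2 y - q2 x * q1 y + q3 x * q0 y)"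
instance
  by intro_classes (simp_all add: quat_eq_iff one_quat_def times_quat_def algebra_simps)
end

lemma quat_mult_sel [simp]:
  "q0 1 = 1" "q1 1 = 0" "q2 1 = 0" "q3 1 = 0"
  "q0 (x * y) = q0 x * q0 y - q1 x * q1 y - q2 x * q2 y - q3 x * q3 y"
  "q1 (x * y) = q0 x * q1 y + q1 x * q0 y + q2 x * q3 y - q3 x * q2 y"
  "q2 (x * y) = q0 x * q2 y - q1 x * q3 y + q2 x * q0 y + q3 x * q1 y"
  "q3 (x * y) = q0 x * q3 y + q1 x * q2 y - q2 x * q1 y + q3 x * q0 y"
  by (simp_all add: one_quat_def times_quat_def)

instantiation quat :: real_vector
begin
definition scaleR_quat where "c *\<^sub>R x = Quat (c * q0 x) (c * q1 x) (c * q2 x) (c * q3 x)"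
instance
  by intro_classes (simp_all add: quat_eq_iff scaleR_quat_def algebra_simps)
end

instantiation quat :: real_inner
begin
definition inner_quat :: "quat \<Rightarrow> quat \<Rightarrow> real" where
  "inner_quat x y = q0 x * q0 y + q1 x * q1 y + q2 x * q2 y + q3 x * q3 y"
definition norm_quat :: "quat \<Rightarrow> real" where "norm_quat x = sqrt (inner x x)"
definition sgn_quat :: "quat \<Rightarrow> quat" where "sgn_quat x = x /\<^sub>R norm x"
definition dist_quat :: "quat \<Rightarrow> quat \<Rightarrow> real" where "dist_quat x y = norm (x - y)"
definition uniformity_quat :: "(quat \<times> quat) filter" where
  [code del]: "uniformity_quat = (INF e\<in>{0 <..}. principal {(x, y). dist x y < e})"
definition open_quat :: "quat set \<Rightarrow> bool" where
  [code del]: "open_quat U \<longleftrightarrow> (\<forall>x\<in>U. eventually (\<lambda>(x', y). x' = x \<longrightarrow> y \<in> U) uniformity)"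
instance
proof
  fix x y z :: quat and a b :: real
  show "inner x y = inner y x" "inner (x + y) z = inner x z + inner y z"
    "inner (a *\<^sub>R x) y = a * inner x y"
    by (simp_all add: inner_quat_def scaleR_quat_def algebra_simps)
  show "0 \<le> inner x x" by (simp add: inner_quat_def)
  show "inner x x = 0 \<longleftrightarrow> x = 0"
    by (simp add: inner_quat_def quat_eq_iff add_nonneg_eq_0_iff)
qed (simp_all add: norm_quat_def sgn_quat_def dist_quat_def uniformity_quat_def open_quat_def)
end

lemma quat_scaleR_sel [simp]:
  "q0 (c *\<^sub>R x) = c * q0 x" "q1 (c *\<^sub>R x) = c * q1 x"
  "q2 (c *\<^sub>R x) = c * q2 x" "q3 (c *\<^sub>R x) = c * q3 x"
  by (simp_all add: scaleR_quat_def)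

lemma norm_quat_mult: "norm (x * y) = norm x * norm (y::quat)"
proof -
  have "inner (x * y) (x * y) = inner x x * inner y y"
    unfolding inner_quat_def quat_mult_sel by algebra
  then show ?thesis
    by (simp add: norm_quat_def real_sqrt_mult)
qed

instance quat :: real_normed_algebra_1
proof
  fix x y :: quat and a :: real
  show "a *\<^sub>R x * y = a *\<^sub>R (x * y)" "x * a *\<^sub>R y = a *\<^sub>R (x * y)"
    by (simp_all add: quat_eq_iff algebra_simps)
  show "norm (1::quat) = 1" by (simp add: norm_quat_def inner_quat_def)
  show "norm (x * y) \<le> norm x * norm y" by (simp add: norm_quat_mult)
qed

instantiation quat :: euclidean_space
begin
definition Basis_quat :: "quat set" where
  "Basis_quat = {Quat 1 0 0 0, Quat 0 1 0 0, Quat 0 0 1 0, Quat 0 0 0 1}"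
instance
proof
  show "(Basis :: quat set) \<noteq> {}" "finite (Basis :: quat set)"
    by (simp_all add: Basis_quat_def)
  show "inner u v = (if u = v then 1 else 0)" if "u \<in> Basis" "v \<in> Basis" for u v :: quat
    using that unfolding Basis_quat_def inner_quat_def
    by (elim insertE emptyE) (simp_all only: quat.sel quat.inject, simp_all)
  show "(\<forall>u\<in>Basis. inner x u = 0) \<longleftrightarrow> x = 0" for x :: quat
    unfolding Basis_quat_def inner_quat_def by (simp, auto simp: quat_eq_iff)
qed
end

definition qcnj :: "quat \<Rightarrow> quat" where
  "qcnj x = Quat (q0 x) (- q1 x) (- q2 x) (- q3 x)"

lemma quat_cnj_sel [simp]:
  "q0 (qcnj x) = q0 x" "q1 (qcnj x) = - q1 x" "q2 (qcnj x) = - q2 x" "q3 (qcnj x) = - q3 x"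
  by (simp_all add: qcnj_def)

lemma qcnj_mult: "qcnj (x * y) = qcnj y * qcnj x"
  by (simp add: quat_eq_iff algebra_simps)

lemma qcnj_mult_self: "norm x = 1 \<Longrightarrow> qcnj x * x = 1" "norm x = 1 \<Longrightarrow> x * qcnj x = 1"
proof -
  assume "norm x = 1"
  then have "q0 x * q0 x + q1 x * q1 x + q2 x * q2 x + q3 x * q3 x = 1"
    by (simp add: norm_quat_def inner_quat_def)
  then show "qcnj x * x = 1" "x * qcnj x = 1"
    by (simp_all add: quat_eq_iff)
qed


section \<open>The group SU(2) and its Lie algebra\<close>

definition SU2 :: "quat set" where "SU2 = {a. norm a = 1}"

definition su2 :: "quat set" where "su2 = {x. q0 x = 0}"

definition T :: "nat \<Rightarrow> quat" where
  "T i = (if i = 1 then Quat 0 1 0 0 else if i = 2 then Quat 0 0 1 0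
          else if i = 3 then Quat 0 0 0 1 else 0)"

definition eps :: "nat \<Rightarrow> nat \<Rightarrow> nat \<Rightarrow> real" where
  "eps i j k = (if (i, j, k) \<in> {(1,2,3), (2,3,1), (3,1,2)} then 1
                else if (i, j, k) \<in> {(1,3,2), (3,2,1), (2,1,3)} then -1 else 0)"

lemma T_commutator:
  assumes "i \<in> {1..3}" "j \<in> {1..3}"
  shows "T i * T j - T j * T i = (\<Sum>k\<in>{1..3}. (2 * eps i j k) *\<^sub>R T k)"
proof -
  have "{1..3} = {1, 2, 3::nat}" by auto
  with assms show ?thesis by (auto simp: T_def eps_def quat_eq_iff)
qed

definition U1 :: "quat set" where "U1 = range (\<lambda>\<theta>. exp (\<theta> *\<^sub>R T 1))"


section \<open>Differential forms\<close>

text \<open>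
  An alternating form at a point is a function of the list of its arguments. The product of a
  form \<open>\<alpha>\<close> of degree \<open>p\<close> with \<open>\<beta>\<close> is the sum over all shuffles: the arguments with positions in
  \<open>I\<close> go to \<open>\<alpha>\<close>, the others to \<open>\<beta>\<close>, and the sign of the shuffle is given by its number of
  inversions. The first factor may be vector valued.
\<close>

definition wedge ::
  "nat \<Rightarrow> ('v list \<Rightarrow> 'b::real_vector) \<Rightarrow> ('v list \<Rightarrow> real) \<Rightarrow> 'v list \<Rightarrow> 'b" where
  "wedge p \<alpha> \<beta> vs =
    (\<Sum>I | I \<subseteq> {..<length vs} \<and> card I = p.
       ((-1) ^ card {(i, j). i \<in> I \<and> j \<in> {..<length vs} - I \<and> j < i} * \<beta> (nths vs (- I)))
         *\<^sub>R \<alpha> (nths vs I))"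

definition form1 :: "('v \<Rightarrow> 'b) \<Rightarrow> 'v list \<Rightarrow> 'b" where
  "form1 \<alpha> vs = \<alpha> (vs ! 0)"

primrec Ck_on ::
  "nat \<Rightarrow> 'a::real_normed_vector set \<Rightarrow> ('a \<Rightarrow> 'b::real_normed_vector) \<Rightarrow> bool" where
  "Ck_on 0 S f \<longleftrightarrow> continuous_on S f"
| "Ck_on (Suc n) S f \<longleftrightarrow>
     f differentiable_on S \<and> (\<forall>v. Ck_on n S (\<lambda>x. frechet_derivative f (at x) v))"

definition smooth_form_on ::
  "'v::real_normed_vector set \<Rightarrow> ('v \<Rightarrow> 'v \<Rightarrow> quat) \<Rightarrow> bool" where
  "smooth_form_on S A \<longleftrightarrow>
     open S \<and> (\<forall>x\<in>S. linear (A x)) \<and> (\<forall>x\<in>S. range (A x) \<subseteq> su2)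
     \<and> (\<forall>v n. Ck_on n S (\<lambda>x. A x v))"

text \<open>
  Curvature \<open>F = dA + [A \<and> A] / 2\<close> of an \<open>su2\<close>-valued 1-form on an open subset of a vector space.
  If the form extends one given on a submanifold, then on vectors tangent to the submanifold
  \<open>F\<close> is the curvature of the given one, independently of the extension.
\<close>

definition curvature ::
  "('v::real_normed_vector \<Rightarrow> 'v \<Rightarrow> quat) \<Rightarrow> 'v \<Rightarrow> 'v list \<Rightarrow> quat" where
  "curvature A x vs =
     (let v = vs ! 0; w = vs ! 1 in
        frechet_derivative (\<lambda>y. A y w) (at x) v - frechet_derivative (\<lambda>y. A y v) (at x) w
        + (A x v * A x w - A x w * A x v))"

text \<open>
  Parallel transport. The sign is chosen so that the holonomy is \<open>exp (\<integral>\<^sub>\<gamma> A)\<close> when the values of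
  \<open>A\<close> along \<open>\<gamma>\<close> commute.
\<close>

definition parallel_along ::
  "('v::real_normed_vector \<Rightarrow> 'v \<Rightarrow> quat) \<Rightarrow> (real \<Rightarrow> 'v) \<Rightarrow> (real \<Rightarrow> quat) \<Rightarrow> bool" where
  "parallel_along A \<gamma> u \<longleftrightarrow>
     (\<forall>\<theta>\<in>{0..1}. (u has_vector_derivative
        A (\<gamma> \<theta>) (vector_derivative \<gamma> (at \<theta>)) * u \<theta>) (at \<theta> within {0..1}))"

definition holonomy ::
  "('v::real_normed_vector \<Rightarrow> 'v \<Rightarrow> quat) \<Rightarrow> (real \<Rightarrow> 'v) \<Rightarrow> quat" where
  "holonomy A \<gamma> = (THE h. \<exists>u. parallel_along A \<gamma> u \<and> u 0 = 1 \<and> h = u 1)"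


section \<open>The principal part of the manifold\<close>

text \<open>
  The manifold \<open>R\<^sup>+ \<times> SU(2) \<times> SU(2)\<close> lies in the vector space \<open>R \<times> H \<times> H\<close>; its tangent
  spaces are subspaces of the latter, and all forms are written on the ambient space.
\<close>

type_synonym point = "real \<times> quat \<times> quat"

definition principal :: "point set" where
  "principal = {(t, a, b). t > 0 \<and> a \<in> SU2 \<and> b \<in> SU2}"

fun tangent :: "point \<Rightarrow> point set" where
  "tangent (t, a, b) = {(\<tau>, v, w). inner a v = 0 \<and> inner b w = 0}"

text \<open>
  The left-invariant forms dual to \<open>(T i, T i)\<close> and \<open>(T i, - T i)\<close>.
\<close>

fun eta_plus :: "nat \<Rightarrow> point \<Rightarrow> point \<Rightarrow> real" where
  "eta_plus i (t, a, b) (\<tau>, v, w) = (inner (qcnj a * v) (T i) + inner (qcnj b * w) (T i)) / 2"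

fun eta_minus :: "nat \<Rightarrow> point \<Rightarrow> point \<Rightarrow> real" where
  "eta_minus i (t, a, b) (\<tau>, v, w) = (inner (qcnj a * v) (T i) - inner (qcnj b * w) (T i)) / 2"

lemma eta_dual:
  assumes "i \<in> {1..3}" "j \<in> {1..3}" "a \<in> SU2" "b \<in> SU2"
  shows "eta_plus i (t, a, b) (\<tau>, a * T j, b * T j) = (if i = j then 1 else 0)"
    and "eta_plus i (t, a, b) (\<tau>, a * T j, b * (- T j)) = 0"
    and "eta_minus i (t, a, b) (\<tau>, a * T j, b * T j) = 0"
    and "eta_minus i (t, a, b) (\<tau>, a * T j, b * (- T j)) = (if i = j then 1 else 0)"
proof -
  have *: "qcnj a * (a * x) = x" "qcnj b * (b * x) = x" for x
    using assms qcnj_mult_self by (simp_all add: SU2_def mult.assoc[symmetric])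
  have ij: "i \<in> {1, 2, 3}" "j \<in> {1, 2, 3}" using assms by auto
  show "eta_plus i (t, a, b) (\<tau>, a * T j, b * T j) = (if i = j then 1 else 0)"
    "eta_plus i (t, a, b) (\<tau>, a * T j, b * (- T j)) = 0"
    "eta_minus i (t, a, b) (\<tau>, a * T j, b * T j) = 0"
    "eta_minus i (t, a, b) (\<tau>, a * T j, b * (- T j)) = (if i = j then 1 else 0)"
    unfolding eta_plus.simps eta_minus.simps * using ij by (auto simp: T_def inner_quat_def)
qed

text \<open>
  The diffeomorphism of the principal part modulo the diagonal stabiliser onto the complement of
  \<open>{0} \<times> S\<^sup>3\<close> in \<open>R\<^sup>4 \<times> S\<^sup>3\<close>.
\<close>

fun orbit_map :: "point \<Rightarrow> quat \<times> quat" where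
  "orbit_map (t, a, b) = (t *\<^sub>R a, a * qcnj b)"

definition R4xS3 :: "(quat \<times> quat) set" where
  "R4xS3 = {(p, q). norm q = 1}"


section \<open>The BGGG structure\<close>

definition t_of_r :: "real \<Rightarrow> real" where
  "t_of_r r = integral {9/4..r} (\<lambda>s. sqrt ((s - 3/4) * (s + 3/4)) / sqrt ((s - 9/4) * (s + 9/4)))"

definition r_of_t :: "real \<Rightarrow> real" where
  "r_of_t = inv_into {9/4..} t_of_r"

definition cA :: "nat \<Rightarrow> real \<Rightarrow> real" where
  "cA i t = (let r = r_of_t t in
     if i = 1 then sqrt ((r - 9/4) * (r + 9/4)) / sqrt ((r - 3/4) * (r + 3/4))
     else sqrt ((r - 9/4) * (r + 3/4) / 3))"

definition cB :: "nat \<Rightarrow> real \<Rightarrow> real" where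
  "cB i t = (let r = r_of_t t in
     if i = 1 then 2 * r / 3 else sqrt ((r - 3/4) * (r + 9/4) / 3))"

definition omega :: "point \<Rightarrow> point list \<Rightarrow> real" where
  "omega x vs = 4 * (\<Sum>i\<in>{1..3}. cA i (fst x) * cB i (fst x)
      * wedge 1 (form1 (eta_minus i x)) (form1 (eta_plus i x)) vs)"

definition Omega2 :: "point \<Rightarrow> point list \<Rightarrow> real" where
  "Omega2 x vs =
     - 8 * cA 1 (fst x) * cA 2 (fst x) * cA 3 (fst x)
       * wedge 1 (form1 (eta_plus 1 x))
           (wedge 1 (form1 (eta_plus 2 x)) (form1 (eta_plus 3 x))) vs
     + 4 * (\<Sum>i\<in>{1..3}. \<Sum>j\<in>{1..3}. \<Sum>k\<in>{1..3}.
         eps i j k * cB i (fst x) * cB j (fst x) * cA k (fst x)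
         * wedge 1 (form1 (eta_minus i x))
             (wedge 1 (form1 (eta_minus j x)) (form1 (eta_plus k x))) vs)"

definition psi :: "point \<Rightarrow> point list \<Rightarrow> real" where
  "psi x vs = wedge 2 (omega x) (omega x) vs / 2 - wedge 1 (form1 fst) (Omega2 x) vs"

definition G2_instanton :: "(point \<Rightarrow> point \<Rightarrow> quat) \<Rightarrow> bool" where
  "G2_instanton A \<longleftrightarrow>
     smooth_form_on {x. fst x > 0} A
     \<and> (\<forall>x\<in>principal. \<forall>vs. length vs = 6 \<and> set vs \<subseteq> tangent x
          \<longrightarrow> wedge 2 (curvature A x) (psi x) vs = 0)"


section \<open>Invariant connections\<close>

definition inv_conn :: "(real \<Rightarrow> real) \<Rightarrow> (real \<Rightarrow> real) \<Rightarrow> point \<Rightarrow> point \<Rightarrow> quat" where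
  "inv_conn f g x v =
     (cA 1 (fst x) * f (fst x) * eta_plus 1 x v) *\<^sub>R T 1
     + (cA 2 (fst x) * g (fst x)) *\<^sub>R (eta_plus 2 x v *\<^sub>R T 2 + eta_plus 3 x v *\<^sub>R T 3)"

lemma inv_conn_left_invariant:
  assumes "c \<in> SU2" "d \<in> SU2"
  shows "inv_conn f g (t, c * a, d * b) (\<tau>, c * v, d * w) = inv_conn f g (t, a, b) (\<tau>, v, w)"
proof -
  have "qcnj c * (c * x) = x" "qcnj d * (d * x) = x" for x
    using assms qcnj_mult_self by (simp_all add: SU2_def mult.assoc[symmetric])
  then show ?thesis by (simp add: inv_conn_def qcnj_mult mult.assoc)
qed

text \<open>
  Right translation by \<open>exp (\<theta> (T 1, T 1))\<close> changes the connection by a constant gauge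
  transformation, so the circle action lifts to the bundle and preserves the connection.
\<close>

lemma inv_conn_right_equivariant:
  assumes "u \<in> SU2" "q2 u = 0" "q3 u = 0"
    "(\<tau>, v, w) \<in> tangent (t, a, b)"
  shows "inv_conn f g (t, a * u, b * u) (\<tau>, v * u, w * u)
       = qcnj u * inv_conn f g (t, a, b) (\<tau>, v, w) * u"
proof -
  define x where "x = qcnj a * v"
  define y where "y = qcnj b * w"
  have x: "q0 x = 0" and y: "q0 y = 0"
    using assms(4) by (auto simp: x_def y_def inner_quat_def algebra_simps)
  have n: "q0 u * q0 u + q1 u * q1 u = 1"
    using assms by (simp add: SU2_def norm_quat_def inner_quat_def)
  have *: "qcnj (a * u) * (v * u) = qcnj u * x * u" "qcnj (b * u) * (w * u) = qcnj u * y * u"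
    by (simp_all add: x_def y_def qcnj_mult mult.assoc)
  have conj: "qcnj u * z * u = Quat 0 (q1 z)
      ((q0 u * q0 u - q1 u * q1 u) * q2 z + 2 * (q0 u * q1 u) * q3 z)
      ((q0 u * q0 u - q1 u * q1 u) * q3 z - 2 * (q0 u * q1 u) * q2 z)" if "q0 z = 0" for z
  proof -
    have "q0 u * q1 z * q0 u + q1 u * q1 z * q1 u = (q0 u * q0 u + q1 u * q1 u) * q1 z"
      by (simp add: algebra_simps)
    then have "q0 u * q1 z * q0 u + q1 u * q1 z * q1 u = q1 z" by (simp add: n)
    with that assms(2,3) show ?thesis
      unfolding quat_eq_iff by (simp add: algebra_simps)
  qed
  have m: "q0 (inv_conn f g (t, a, b) (\<tau>, v, w)) = 0"
    by (simp add: inv_conn_def T_def)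
  show ?thesis
    unfolding conj[OF m]
    unfolding inv_conn_def eta_plus.simps * conj[OF x] conj[OF y] x_def[symmetric] y_def[symmetric]
    unfolding quat_eq_iff
    by (simp add: T_def inner_quat_def field_simps)
qed

text \<open>
  The isotropy homomorphism is trivial, so the bundle over \<open>S\<^sup>3\<close>, and its pullback to
  \<open>R\<^sup>4 \<times> S\<^sup>3\<close>, is the product bundle with \<open>SU(2) \<times> SU(2)\<close> acting trivially on the fibre. A
  connection on it is an \<open>su2\<close>-valued 1-form on \<open>R\<^sup>4 \<times> S\<^sup>3\<close>, and its description in the invariant
  framing over the principal part is its pullback by \<open>orbit_map\<close>. Smooth forms on the embedded
  submanifold are the restrictions of smooth forms on its open neighbourhoods.
\<close>

definition extends_smoothly_on_P1 :: "(point \<Rightarrow> point \<Rightarrow> quat) \<Rightarrow> bool" where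
  "extends_smoothly_on_P1 A \<longleftrightarrow>
     (\<exists>S A'. R4xS3 \<subseteq> S \<and> smooth_form_on S A'
        \<and> (\<forall>x\<in>principal. \<forall>v\<in>tangent x.
              A x v = A' (orbit_map x) (frechet_derivative orbit_map (at x) v)))"


section \<open>Holonomy at infinity\<close>

definition circ :: "real \<Rightarrow> real \<Rightarrow> point" where
  "circ t \<theta> = (t, exp ((2 * pi * \<theta>) *\<^sub>R T 1), exp ((2 * pi * \<theta>) *\<^sub>R T 1))"

lemma exp_T1: "exp (x *\<^sub>R T 1) = Quat (cos x) (sin x) 0 0"
proof -
  define C where "C x = cos x *\<^sub>R (1::quat) + sin x *\<^sub>R T 1" for x
  have T2: "T 1 * T 1 = -1" by (simp add: T_def quat_eq_iff)
  have "((\<lambda>x. C x * exp (x *\<^sub>R (- T 1))) has_vector_derivative 0) (at x within UNIV)" for x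
  proof -
    have "(C has_vector_derivative C x * T 1) (at x within UNIV)"
      unfolding C_def by (auto intro!: derivative_eq_intros simp: algebra_simps T2[simplified])
    from has_vector_derivative_mult[OF this exp_scaleR_has_vector_derivative_left[of "- T 1"]]
    show ?thesis by (simp add: mult.assoc)
  qed
  then obtain c where c: "C x * exp (x *\<^sub>R (- T 1)) = c" for x
    using has_vector_derivative_zero_constant[of UNIV "\<lambda>x. C x * exp (x *\<^sub>R (- T 1))"] by auto
  have "c = 1" using c[of 0] by (simp add: C_def)
  then have "C x = exp (x *\<^sub>R T 1)"
    using c[of x] exp_minus_inverse[of "- (x *\<^sub>R T 1)"]
    by (metis mult.assoc mult_1 mult.right_neutral minus_minus scaleR_minus_right)
  then show ?thesis by (simp add: C_def T_def quat_eq_iff)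
qed

lemma holonomy_circ:
  "holonomy (inv_conn f g) (circ t) = exp ((2 * pi * cA 1 t * f t) *\<^sub>R T 1)"
proof -
  define c where "c = (2 * pi * cA 1 t * f t) *\<^sub>R T 1"
  have val: "inv_conn f g (circ t \<theta>) (vector_derivative (circ t) (at \<theta>)) = c" for \<theta>
  proof -
    define E where "E = exp ((2 * pi * \<theta>) *\<^sub>R T 1)"
    have "((\<lambda>\<theta>. exp ((2 * pi * \<theta>) *\<^sub>R T 1)) has_vector_derivative (2 * pi) *\<^sub>R (E * T 1)) (at \<theta>)"
      using exp_scaleR_has_vector_derivative_right[of "(2 * pi) *\<^sub>R T 1" \<theta> UNIV]
      by (simp add: E_def mult_ac)
    then have "(circ t has_vector_derivative (0, (2 * pi) *\<^sub>R (E * T 1), (2 * pi) *\<^sub>R (E * T 1))) (at \<theta>)"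
      unfolding circ_def by (intro has_vector_derivative_Pair has_vector_derivative_const)
    then have vd: "vector_derivative (circ t) (at \<theta>) =
        (0, (2 * pi) *\<^sub>R (E * T 1), (2 * pi) *\<^sub>R (E * T 1))"
      by (rule vector_derivative_at)
    have "norm E = 1"
      unfolding E_def exp_T1 by (simp add: norm_quat_def inner_quat_def flip: power2_eq_square)
    then have "qcnj E * (E * T 1) = T 1"
      by (simp add: qcnj_mult_self flip: mult.assoc)
    then have "eta_plus i (circ t \<theta>) (vector_derivative (circ t) (at \<theta>)) = 2 * pi * inner (T 1) (T i)"
      for i unfolding vd unfolding circ_def E_def[symmetric] by simp
    then show ?thesis
      by (simp add: inv_conn_def c_def T_def inner_quat_def) (simp add: circ_def mult_ac)
  qed
  have unique: "u 1 = exp c" if "parallel_along (inv_conn f g) (circ t) u" "u 0 = 1" for u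
  proof -
    have "((\<lambda>\<theta>. exp (\<theta> *\<^sub>R (- c)) * u \<theta>) has_vector_derivative 0) (at \<theta> within {0..1})"
      if "\<theta> \<in> {0..1}" for \<theta>
    proof -
      have "(u has_vector_derivative c * u \<theta>) (at \<theta> within {0..1})"
        using \<open>parallel_along _ _ u\<close> that by (simp add: parallel_along_def val)
      from has_vector_derivative_mult[OF exp_scaleR_has_vector_derivative_right[of "- c"] this]
      show ?thesis by (simp add: mult.assoc)
    qed
    then obtain k where "\<And>\<theta>. \<theta> \<in> {0..1} \<Longrightarrow> exp (\<theta> *\<^sub>R (- c)) * u \<theta> = k"
      using has_vector_derivative_zero_constant[of "{0..1}" "\<lambda>\<theta>. exp (\<theta> *\<^sub>R (- c)) * u \<theta>"] by auto
    from this[of 0] this[of 1] \<open>u 0 = 1\<close> have "exp (- c) * u 1 = 1" by simp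
    then show ?thesis
      using exp_minus_inverse[of c] by (metis mult.assoc mult_1 mult.right_neutral)
  qed
  have "parallel_along (inv_conn f g) (circ t) (\<lambda>\<theta>. exp (\<theta> *\<^sub>R c))"
    unfolding parallel_along_def val by (auto intro: exp_scaleR_has_vector_derivative_left has_vector_derivative_at_within)
  then show ?thesis
    unfolding holonomy_def c_def[symmetric]
    by (intro the_equality) (auto intro!: exI[of _ "\<lambda>\<theta>. exp (\<theta> *\<^sub>R c)"] dest: unique)
qed

definition Hol_infty :: "(point \<Rightarrow> point \<Rightarrow> quat) \<Rightarrow> quat" where
  "Hol_infty A = Lim at_top (\<lambda>t. holonomy A (circ t))"

end

theory Submission
  imports Defs "HOL-Real_Asymp.Real_Asymp"
begin

text \<open>
  Put \<open>F = A\<^sub>1 f\<close> and \<open>G = A\<^sub>2 g\<close>, so that the holonomy around \<open>\<gamma>\<^sub>t\<close> is \<open>exp (2 \<pi> F(t) T\<^sub>1)\<close>. The BGGG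
  coefficients satisfy \<open>dr/dt = A\<^sub>1\<close>, and in the variable \<open>s = r - 9/4\<close> the functions
  \<open>x = F / A\<^sub>1\<^sup>2 - 1\<close> and a rational rescaling \<open>k\<close> of \<open>G\<close> solve \<open>x' = - k\<^sup>2\<close>, \<open>k' = - k (x + q)\<close> with
  \<open>q \<ge> 0\<close>, regular up to \<open>s = 0\<close>, where \<open>x = 2 f\<^sub>1 - 1\<close> and \<open>k = 2 g\<^sub>1\<close>. As \<open>x\<^sup>2 - k\<^sup>2\<close> is nondecreasing,
  \<open>x\<close> decreases to a limit \<open>x\<^sub>\<infinity> \<ge> sqrt ((2 f\<^sub>1 - 1)\<^sup>2 - (2 g\<^sub>1)\<^sup>2)\<close> and \<open>k\<close> decays exponentially. The decay
  makes \<open>x\<^sub>\<infinity>\<close> locally Lipschitz in \<open>f\<^sub>1\<close>. The limit of \<open>F\<close> is \<open>1 + x\<^sub>\<infinity>\<close>, which is therefore continuous and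
  unbounded above in \<open>f\<^sub>1\<close>, so \<open>exp (2 \<pi> (1 + x\<^sub>\<infinity>) T\<^sub>1)\<close> runs through all of \<open>U(1)\<close>.
\<close>

section \<open>Shuffle products on short lists\<close>

lemma wedge_0: "wedge 0 \<alpha> \<beta> vs = \<beta> vs *\<^sub>R \<alpha> []"
proof -
  have "{I. I \<subseteq> {..<length vs} \<and> card I = 0} = {{}}"
    using finite_subset[OF _ finite_lessThan] by auto
  then show ?thesis by (simp add: wedge_def nths_all)
qed

lemma wedge_Suc_Nil: "wedge (Suc p) \<alpha> \<beta> [] = 0"
  unfolding wedge_def by (rule sum.neutral) auto

text \<open>Shuffles are split by whether the first argument goes to \<alpha>. If it goes to
  \<beta>, each of the \<open>Suc p\<close> positions taken by \<alpha> is inverted with it, which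
  gives the sign. Iterating this expands a product on an explicit list without enumerating
  subsets.\<close>

lemma wedge_Suc_Cons:
  "wedge (Suc p) \<alpha> \<beta> (v # vs) =
     wedge p (\<lambda>us. \<alpha> (v # us)) \<beta> vs + (-1) ^ Suc p *\<^sub>R wedge (Suc p) \<alpha> (\<lambda>us. \<beta> (v # us)) vs"
proof -
  define n where "n = length vs"
  define inv where "inv m I = {(i, j). i \<in> I \<and> j \<in> {..<m} - I \<and> j < i}" for m and I :: "nat set"
  define summand where "summand I = ((-1) ^ card (inv (Suc n) I) * \<beta> (nths (v # vs) (- I)))
    *\<^sub>R \<alpha> (nths (v # vs) I)" for I
  define S where "S m q = {I :: nat set. I \<subseteq> {..<m} \<and> card I = q}" for m q
  define f where "f J = insert 0 (Suc ` J)" for J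
  have fin: "finite J" if "J \<in> S m q" for J m q
    using that finite_subset by (auto simp: S_def)
  have finS: "finite (S m q)" for m q
    unfolding S_def by (rule finite_subset[of _ "Pow {..<m}"]) auto
  have fininv: "finite (inv m J)" if "J \<in> S m q" for J m q
    by (rule finite_subset[of _ "J \<times> {..<m}"]) (use fin[OF that] in \<open>auto simp: inv_def\<close>)
  have inj_f: "inj_on f X" for X
    by (auto simp: f_def inj_on_def)
  have inj_g: "inj_on ((`) Suc) X" for X
    by (auto simp: inj_on_def)
  have card_f: "card (f J) = Suc (card J)" if "J \<in> S n q" for J q
    using fin[OF that] by (simp add: f_def card_image)
  have split: "S (Suc n) (Suc p) = f ` S n p \<union> (`) Suc ` S n (Suc p)" (is "?L = ?R")
  proof (intro equalityI subsetI)
    fix I assume I: "I \<in> ?L"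
    define J where "J = {i. Suc i \<in> I}"
    have J: "J \<subseteq> {..<n}" using I by (auto simp: S_def J_def)
    then have finJ: "finite J" using finite_subset by blast
    have *: "I = (if 0 \<in> I then f J else Suc ` J)"
      unfolding f_def J_def by (auto simp: image_iff) (metis not0_implies_Suc)+
    have "card I = (if 0 \<in> I then Suc (card J) else card J)"
      by (subst *) (use finJ in \<open>auto simp: f_def card_image\<close>)
    with I J have "J \<in> S n (if 0 \<in> I then p else Suc p)" by (auto simp: S_def)
    with * show "I \<in> ?R" by (auto split: if_splits)
  next
    fix I assume "I \<in> ?R"
    then show "I \<in> ?L" using card_f by (auto simp: S_def f_def card_image)
  qed
  have disj: "f ` S n p \<inter> (`) Suc ` S n (Suc p) = {}"
    by (auto simp: f_def)
  have t1: "summand (f J) = ((-1) ^ card (inv n J) * \<beta> (nths vs (- J))) *\<^sub>R \<alpha> (v # nths vs J)"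
    if "J \<in> S n p" for J
  proof -
    \<comment> \<open>Position \<open>0\<close> belongs to \<open>f J\<close>, so it is neither the
      smaller member of an inversion nor, being minimal, the larger one.\<close>
    have "inv (Suc n) (f J) = map_prod Suc Suc ` inv n J" (is "?A = ?B")
    proof (intro equalityI subsetI)
      fix z assume "z \<in> ?A"
      then obtain i j where z: "z = (i, j)" "i \<in> f J" "j < Suc n" "j \<notin> f J" "j < i"
        by (auto simp: inv_def)
      then obtain i' j' where "i = Suc i'" "j = Suc j'"
        by (metis f_def insertI1 less_nat_zero_code not0_implies_Suc)
      with z show "z \<in> ?B" by (auto simp: inv_def f_def)
    qed (auto simp: inv_def f_def)
    then have "card (inv (Suc n) (f J)) = card (inv n J)"
      by (simp add: card_image prod.inj_map inj_on_subset[OF _ subset_UNIV])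
    moreover have "{j. Suc j \<in> f J} = J" "{j. Suc j \<in> - f J} = - J" by (auto simp: f_def)
    moreover have "0 \<in> f J" by (simp add: f_def)
    ultimately show ?thesis
      by (simp add: summand_def nths_Cons)
  qed
  have t2: "summand (Suc ` J) =
      (-1) ^ Suc p *\<^sub>R ((-1) ^ card (inv n J) * \<beta> (v # nths vs (- J))) *\<^sub>R \<alpha> (nths vs J)"
    if "J \<in> S n (Suc p)" for J
  proof -
    have "inv (Suc n) (Suc ` J) = map_prod Suc Suc ` inv n J \<union> (\<lambda>i. (Suc i, 0)) ` J" (is "?A = ?B")
    proof (intro equalityI subsetI)
      fix z assume "z \<in> ?A"
      then obtain i j where z: "z = (Suc i, j)" "i \<in> J" "j < Suc n" "j \<notin> Suc ` J" "j < Suc i"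
        by (auto simp: inv_def)
      then show "z \<in> ?B" by (cases j) (auto simp: inv_def)
    qed (use that in \<open>auto simp: inv_def S_def\<close>)
    moreover have "card (map_prod Suc Suc ` inv n J \<union> (\<lambda>i. (Suc i, 0)) ` J)
        = card (map_prod Suc Suc ` inv n J) + card ((\<lambda>i. (Suc i, 0::nat)) ` J)"
      by (rule card_Un_disjoint) (use fin[OF that] fininv[OF that] in auto)
    moreover have "card (map_prod Suc Suc ` inv n J) = card (inv n J)"
      by (simp add: card_image prod.inj_map inj_on_subset[OF _ subset_UNIV])
    moreover have "card ((\<lambda>i. (Suc i, 0::nat)) ` J) = Suc p"
      using that by (subst card_image) (auto simp: inj_on_def S_def)
    ultimately have "card (inv (Suc n) (Suc ` J)) = card (inv n J) + Suc p" by simp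
    moreover have "{j. Suc j \<in> Suc ` J} = J" "{j. Suc j \<in> - Suc ` J} = - J" by auto
    ultimately show ?thesis
      by (simp add: summand_def nths_Cons power_add mult_ac)
  qed
  have "wedge (Suc p) \<alpha> \<beta> (v # vs) = (\<Sum>I\<in>S (Suc n) (Suc p). summand I)"
    by (simp add: wedge_def S_def summand_def inv_def n_def)
  also have "\<dots> = (\<Sum>J\<in>S n p. summand (f J)) + (\<Sum>J\<in>S n (Suc p). summand (Suc ` J))"
    unfolding split by (subst sum.union_disjoint) (use finS disj in \<open>auto simp: sum.reindex[OF inj_f] sum.reindex[OF inj_g]\<close>)
  also have "(\<Sum>J\<in>S n p. summand (f J)) = wedge p (\<lambda>us. \<alpha> (v # us)) \<beta> vs"
    using t1 by (simp add: wedge_def S_def inv_def n_def)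
  also have "(\<Sum>J\<in>S n (Suc p). summand (Suc ` J)) = (-1) ^ Suc p *\<^sub>R wedge (Suc p) \<alpha> (\<lambda>us. \<beta> (v # us)) vs"
    unfolding wedge_def scaleR_sum_right S_def[symmetric] inv_def[symmetric] n_def[symmetric]
    by (rule sum.cong[OF refl t2])
  finally show ?thesis .
qed

lemma wedge_1_2: "wedge 1 \<alpha> \<beta> [a, b] = \<beta> [b] *\<^sub>R \<alpha> [a] - \<beta> [a] *\<^sub>R \<alpha> [b]"
  by (simp add: wedge_Suc_Cons wedge_Suc_Nil wedge_0)

lemma wedge_1_3:
  "wedge 1 \<alpha> \<beta> [a, b, c] = \<beta> [b, c] *\<^sub>R \<alpha> [a] - \<beta> [a, c] *\<^sub>R \<alpha> [b] + \<beta> [a, b] *\<^sub>R \<alpha> [c]"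
  by (simp add: wedge_Suc_Cons wedge_Suc_Nil wedge_0 algebra_simps)

lemma wedge_1_4:
  "wedge 1 \<alpha> \<beta> [a, b, c, d] = \<beta> [b, c, d] *\<^sub>R \<alpha> [a] - \<beta> [a, c, d] *\<^sub>R \<alpha> [b]
     + \<beta> [a, b, d] *\<^sub>R \<alpha> [c] - \<beta> [a, b, c] *\<^sub>R \<alpha> [d]"
  by (simp add: wedge_Suc_Cons wedge_Suc_Nil wedge_0 algebra_simps)

lemma wedge_2_4:
  "wedge 2 \<alpha> \<beta> [a, b, c, d] = \<beta> [c, d] *\<^sub>R \<alpha> [a, b] - \<beta> [b, d] *\<^sub>R \<alpha> [a, c] + \<beta> [b, c] *\<^sub>R \<alpha> [a, d]
     + \<beta> [a, d] *\<^sub>R \<alpha> [b, c] - \<beta> [a, c] *\<^sub>R \<alpha> [b, d] + \<beta> [a, b] *\<^sub>R \<alpha> [c, d]"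
  by (simp add: wedge_Suc_Cons wedge_Suc_Nil wedge_0 numeral_2_eq_2 algebra_simps)

lemma wedge_2_6:
  "wedge 2 \<alpha> \<beta> [a, b, c, d, e, f] =
     \<beta> [c, d, e, f] *\<^sub>R \<alpha> [a, b] - \<beta> [b, d, e, f] *\<^sub>R \<alpha> [a, c] + \<beta> [b, c, e, f] *\<^sub>R \<alpha> [a, d]
     - \<beta> [b, c, d, f] *\<^sub>R \<alpha> [a, e] + \<beta> [b, c, d, e] *\<^sub>R \<alpha> [a, f]
     + \<beta> [a, d, e, f] *\<^sub>R \<alpha> [b, c] - \<beta> [a, c, e, f] *\<^sub>R \<alpha> [b, d] + \<beta> [a, c, d, f] *\<^sub>R \<alpha> [b, e]
     - \<beta> [a, c, d, e] *\<^sub>R \<alpha> [b, f] + \<beta> [a, b, e, f] *\<^sub>R \<alpha> [c, d] - \<beta> [a, b, d, f] *\<^sub>R \<alpha> [c, e]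
     + \<beta> [a, b, d, e] *\<^sub>R \<alpha> [c, f] + \<beta> [a, b, c, f] *\<^sub>R \<alpha> [d, e] - \<beta> [a, b, c, e] *\<^sub>R \<alpha> [d, f]
     + \<beta> [a, b, c, d] *\<^sub>R \<alpha> [e, f]"
  by (simp add: wedge_Suc_Cons wedge_Suc_Nil wedge_0 numeral_2_eq_2 algebra_simps)


section \<open>The instanton equations\<close>

lemma linear_eta_plus:
  "linear (eta_plus i x)" "linear (\<lambda>x. eta_plus i x v)"
  by (cases x, cases v, simp, rule linearI,
      auto simp: inner_quat_def T_def algebra_simps add_divide_distrib diff_divide_distrib)+

text \<open>The ambient extension of the form is linear in the base point as well, so its derivative
  in direction \<open>u\<close> is the same expression with \<open>u\<close> as base point. The
  structure equations of the group enter only through these values.\<close>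

lemma eta_plus_has_derivative:
  "((\<lambda>y. eta_plus i y v) has_derivative (\<lambda>u. eta_plus i u v)) (at x)"
  using linear_eta_plus(2) linear_conv_bounded_linear bounded_linear_imp_has_derivative by blast

lemma curvature_inv_conn:
  assumes c1: "((\<lambda>t. cA 1 t * f t) has_real_derivative c1') (at (fst x))"
    and c2: "((\<lambda>t. cA 2 t * g t) has_real_derivative c2') (at (fst x))"
  shows "curvature (inv_conn f g) x [v, w] =
     (fst v * c1' * eta_plus 1 x w - fst w * c1' * eta_plus 1 x v
       + cA 1 (fst x) * f (fst x) * (eta_plus 1 v w - eta_plus 1 w v)) *\<^sub>R T 1
     + (\<Sum>i\<in>{2, 3}. (fst v * c2' * eta_plus i x w - fst w * c2' * eta_plus i x v
       + cA 2 (fst x) * g (fst x) * (eta_plus i v w - eta_plus i w v)) *\<^sub>R T i)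
     + (inv_conn f g x v * inv_conn f g x w - inv_conn f g x w * inv_conn f g x v)"
proof -
  have fst_comp: "((\<lambda>y. h (fst y)) has_derivative (\<lambda>u. fst u * h')) (at x)"
    if "(h has_real_derivative h') (at (fst x))" for h :: "real \<Rightarrow> real" and h'
    using has_derivative_compose[OF has_derivative_fst[OF has_derivative_ident]
        that[unfolded has_field_derivative_def]] by (simp add: mult.commute)
  have fd: "frechet_derivative (\<lambda>y. inv_conn f g y w) (at x) v =
     (fst v * c1' * eta_plus 1 x w + cA 1 (fst x) * f (fst x) * eta_plus 1 v w) *\<^sub>R T 1
     + (fst v * c2') *\<^sub>R (eta_plus 2 x w *\<^sub>R T 2 + eta_plus 3 x w *\<^sub>R T 3)
     + (cA 2 (fst x) * g (fst x)) *\<^sub>R (eta_plus 2 v w *\<^sub>R T 2 + eta_plus 3 v w *\<^sub>R T 3)" for v w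
  proof (subst frechet_derivative_at[symmetric])
    show "((\<lambda>y. inv_conn f g y w) has_derivative (\<lambda>v.
     (fst v * c1' * eta_plus 1 x w + cA 1 (fst x) * f (fst x) * eta_plus 1 v w) *\<^sub>R T 1
     + (fst v * c2') *\<^sub>R (eta_plus 2 x w *\<^sub>R T 2 + eta_plus 3 x w *\<^sub>R T 3)
     + (cA 2 (fst x) * g (fst x)) *\<^sub>R (eta_plus 2 v w *\<^sub>R T 2 + eta_plus 3 v w *\<^sub>R T 3))) (at x)"
      unfolding inv_conn_def
      by (rule derivative_eq_intros fst_comp[OF c1] fst_comp[OF c2] eta_plus_has_derivative refl)+
        (auto simp: fun_eq_iff algebra_simps)
  qed simp
  show ?thesis
    unfolding curvature_def fd by (simp add: Let_def algebra_simps)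
qed

lemma sum_1_3: "(\<Sum>i\<in>{1..3}. h i) = h 1 + h 2 + h (3::nat)"
proof -
  have "{1..3} = {1, 2, 3::nat}" by auto
  then show ?thesis by (simp add: add.assoc)
qed

section \<open>Evaluation on the invariant frame at \<open>(t, 1, 1)\<close>\<close>

definition frame_t :: point where "frame_t = (1, 0, 0)"
definition frame_plus :: "nat \<Rightarrow> point" where "frame_plus i = (0, T i, T i)"
definition frame_minus :: "nat \<Rightarrow> point" where "frame_minus i = (0, T i, - T i)"

lemma T_sel:
  "q0 (T i) = 0" "q1 (T 1) = 1" "q1 (T 2) = 0" "q1 (T 3) = 0"
  "q2 (T 1) = 0" "q2 (T 2) = 1" "q2 (T 3) = 0" "q3 (T 1) = 0" "q3 (T 2) = 0" "q3 (T 3) = 1"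
  "q1 (T (Suc 0)) = 1" "q2 (T (Suc 0)) = 0" "q3 (T (Suc 0)) = 0"
  by (simp_all add: T_def)

lemma fst_frame: "fst frame_t = 1" "fst (frame_plus i) = 0" "fst (frame_minus i) = 0"
  by (simp_all add: frame_t_def frame_plus_def frame_minus_def)

lemma eta_frame:
  assumes "i \<in> {1, 2, 3}" "j \<in> {1, 2, 3}"
  shows "eta_plus i (t, 1, 1) frame_t = 0" "eta_minus i (t, 1, 1) frame_t = 0"
    "eta_plus i (t, 1, 1) (frame_plus j) = (if i = j then 1 else 0)" "eta_plus i (t, 1, 1) (frame_minus j) = 0"
    "eta_minus i (t, 1, 1) (frame_minus j) = (if i = j then 1 else 0)" "eta_minus i (t, 1, 1) (frame_plus j) = 0"
  using assms by (auto simp: frame_t_def frame_plus_def frame_minus_def inner_quat_def T_sel)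

text \<open>As \<open>qcnj (T j) = - T j\<close>, this is the imaginary part of
  \<open>- T j * T k\<close>. Antisymmetrised in \<open>j\<close> and \<open>k\<close>, it gives the
  exterior derivatives of the invariant forms.\<close>

lemma inner_T_mult:
  assumes "i \<in> {1, 2, 3}" "j \<in> {1, 2, 3}" "k \<in> {1, 2, 3}"
  shows "inner (qcnj (T j) * T k) (T i) = - eps i j k"
  using assms unfolding inner_quat_def eps_def
  by (elim insertE emptyE; hypsubst; simp add: T_sel)

lemma eta_plus_frame_t: "eta_plus i frame_t v = 0" "eta_plus i v frame_t = 0"
  by (cases v; simp add: frame_t_def inner_quat_def)+

lemma eta_frame_frame:
  assumes "i \<in> {1, 2, 3}" "j \<in> {1, 2, 3}" "k \<in> {1, 2, 3}"
  shows "eta_plus i (frame_plus j) (frame_plus k) = - eps i j k"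
    "eta_plus i (frame_minus j) (frame_minus k) = - eps i j k"
    "eta_plus i (frame_plus j) (frame_minus k) = 0"
    "eta_plus i (frame_minus j) (frame_plus k) = 0"
proof -
  have "qcnj (- T j) = - qcnj (T j)" by (simp add: quat_eq_iff)
  then show "eta_plus i (frame_plus j) (frame_plus k) = - eps i j k" "eta_plus i (frame_minus j) (frame_minus k) = - eps i j k"
    "eta_plus i (frame_plus j) (frame_minus k) = 0" "eta_plus i (frame_minus j) (frame_plus k) = 0"
    by (simp_all add: frame_plus_def frame_minus_def inner_T_mult[OF assms])
qed

lemma omega_pair:
  "omega x [v, w] = 4 * (cA 1 (fst x) * cB 1 (fst x) * (eta_minus 1 x v * eta_plus 1 x w - eta_minus 1 x w * eta_plus 1 x v)
     + cA 2 (fst x) * cB 2 (fst x) * (eta_minus 2 x v * eta_plus 2 x w - eta_minus 2 x w * eta_plus 2 x v)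
     + cA 3 (fst x) * cB 3 (fst x) * (eta_minus 3 x v * eta_plus 3 x w - eta_minus 3 x w * eta_plus 3 x v))"
  unfolding omega_def sum_1_3 wedge_1_2 form1_def by (simp add: mult.commute)

definition vol3 :: "('v \<Rightarrow> real) \<Rightarrow> ('v \<Rightarrow> real) \<Rightarrow> ('v \<Rightarrow> real) \<Rightarrow> 'v \<Rightarrow> 'v \<Rightarrow> 'v \<Rightarrow> real" where
  "vol3 a b c u v w = a u * (b v * c w - b w * c v) - a v * (b u * c w - b w * c u)
     + a w * (b u * c v - b v * c u)"

lemma wedge_vol3: "wedge 1 (form1 a) (wedge 1 (form1 b) (form1 c)) [u, v, w] = vol3 a b c u v w"
  unfolding wedge_1_3 wedge_1_2 form1_def vol3_def by (simp add: algebra_simps)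

lemma vol3_swap: "vol3 b a c u v w = - vol3 a b c u v w"
  by (simp add: vol3_def algebra_simps)

text \<open>Exchanging the two minus-indices changes the sign of both \<open>eps\<close> and
  \<open>vol3\<close>, so every term of the triple sum occurs twice and the factor 4 becomes
  8.\<close>

lemma Omega2_triple:
  "Omega2 x [u, v, w] = - 8 * cA 1 (fst x) * cA 2 (fst x) * cA 3 (fst x) * vol3 (eta_plus 1 x) (eta_plus 2 x) (eta_plus 3 x) u v w
    + 8 * (cB 1 (fst x) * cB 2 (fst x) * cA 3 (fst x) * vol3 (eta_minus 1 x) (eta_minus 2 x) (eta_plus 3 x) u v w
      + cB 2 (fst x) * cB 3 (fst x) * cA 1 (fst x) * vol3 (eta_minus 2 x) (eta_minus 3 x) (eta_plus 1 x) u v w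
      + cB 3 (fst x) * cB 1 (fst x) * cA 2 (fst x) * vol3 (eta_minus 3 x) (eta_minus 1 x) (eta_plus 2 x) u v w)"
  unfolding Omega2_def sum_1_3 wedge_vol3
  using vol3_swap[of "eta_minus 2 x" "eta_minus 1 x" "eta_plus 3 x" u v w]
    vol3_swap[of "eta_minus 3 x" "eta_minus 2 x" "eta_plus 1 x" u v w]
    vol3_swap[of "eta_minus 1 x" "eta_minus 3 x" "eta_plus 2 x" u v w]
  by (simp add: eps_def algebra_simps)

lemma psi_list:
  "psi x [a, b, c, d] = omega x [a, b] * omega x [c, d] - omega x [a, c] * omega x [b, d] + omega x [a, d] * omega x [b, c]
     - (fst a * Omega2 x [b, c, d] - fst b * Omega2 x [a, c, d] + fst c * Omega2 x [a, b, d] - fst d * Omega2 x [a, b, c])"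
  unfolding psi_def wedge_2_4 wedge_1_4 form1_def by (simp add: field_simps)

text \<open>These are the equations for the invariant coefficients with denominators cleared.
  Written for \<open>F\<close> and \<open>G\<close> instead of \<open>f\<close> and
  \<open>g\<close>, they contain no derivatives of the metric coefficients.\<close>

lemma instanton_ode:
  assumes inst: "G2_instanton (inv_conn f g)" and t: "t > 0"
    and c1: "((\<lambda>t. cA 1 t * f t) has_real_derivative c1') (at t)"
    and c2: "((\<lambda>t. cA 2 t * g t) has_real_derivative c2') (at t)"
  defines "F \<equiv> cA 1 t * f t" and "G \<equiv> cA 2 t * g t"
  shows "c1' * (cA 2 t * cB 2 t)\<^sup>2 = cA 1 t * (cB 2 t)\<^sup>2 * (F - G\<^sup>2) - cA 1 t * (cA 2 t)\<^sup>2 * F"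
    and "c2' * (cA 1 t * cB 1 t * cA 2 t * cB 2 t) = cA 2 t * cB 1 t * cB 2 t * G * (1 - F) - cA 1 t * (cA 2 t)\<^sup>2 * G"
proof -
  let ?x = "(t, 1, 1) :: point"
  have x: "?x \<in> principal" using t by (simp add: principal_def SU2_def)
  have tan: "frame_t \<in> tangent ?x" "\<And>i. frame_plus i \<in> tangent ?x" "\<And>i. frame_minus i \<in> tangent ?x"
    by (auto simp: frame_t_def frame_plus_def frame_minus_def inner_quat_def T_sel)
  have c3: "cA 3 t = cA 2 t" "cB 3 t = cB 2 t" by (simp_all add: cA_def cB_def)
  have conn: "inv_conn f g ?x v = F *\<^sub>R eta_plus 1 ?x v *\<^sub>R T 1 + G *\<^sub>R (eta_plus 2 ?x v *\<^sub>R T 2 + eta_plus 3 ?x v *\<^sub>R T 3)" for v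
    by (simp add: inv_conn_def F_def G_def)
  have curv: "curvature (inv_conn f g) ?x [v, w] = (fst v * c1' * eta_plus 1 ?x w - fst w * c1' * eta_plus 1 ?x v
       + F * (eta_plus 1 v w - eta_plus 1 w v)) *\<^sub>R T 1
     + ((fst v * c2' * eta_plus 2 ?x w - fst w * c2' * eta_plus 2 ?x v
       + G * (eta_plus 2 v w - eta_plus 2 w v)) *\<^sub>R T 2 + (fst v * c2' * eta_plus 3 ?x w - fst w * c2' * eta_plus 3 ?x v
       + G * (eta_plus 3 v w - eta_plus 3 w v)) *\<^sub>R T 3)
     + (inv_conn f g ?x v * inv_conn f g ?x w - inv_conn f g ?x w * inv_conn f g ?x v)" for v w
    using curvature_inv_conn[of f c1' ?x g c2' v w] c1 c2 unfolding F_def G_def by simp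
  note evals = wedge_2_6 psi_list omega_pair Omega2_triple curv conn vol3_def eta_plus_frame_t eta_frame eta_frame_frame
    fst_frame T_sel eps_def c3
  \<comment> \<open>Leaving out \<open>frame_minus 1\<close> isolates the \<open>T 1\<close>-component of the equation, leaving out
    \<open>frame_minus 2\<close> the \<open>T 2\<close>-component; the third one agrees with the second by symmetry.\<close>
  have "wedge 2 (curvature (inv_conn f g) ?x) (psi ?x)
      [frame_t, frame_plus 1, frame_minus 2, frame_plus 2, frame_minus 3, frame_plus 3] = 0"
    using inst x tan unfolding G2_instanton_def by (auto simp del: tangent.simps)
  from arg_cong[OF this, of q1]
  show "c1' * (cA 2 t * cB 2 t)\<^sup>2 = cA 1 t * (cB 2 t)\<^sup>2 * (F - G\<^sup>2) - cA 1 t * (cA 2 t)\<^sup>2 * F"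
    by (simp add: evals) (simp add: power2_eq_square algebra_simps)
  have "wedge 2 (curvature (inv_conn f g) ?x) (psi ?x)
      [frame_t, frame_plus 2, frame_minus 3, frame_plus 3, frame_minus 1, frame_plus 1] = 0"
    using inst x tan unfolding G2_instanton_def by (auto simp del: tangent.simps)
  from arg_cong[OF this, of q2]
  show "c2' * (cA 1 t * cB 1 t * cA 2 t * cB 2 t) = cA 2 t * cB 1 t * cB 2 t * G * (1 - F) - cA 1 t * (cA 2 t)\<^sup>2 * G"
    by (simp add: evals) (simp add: power2_eq_square algebra_simps)
qed

text \<open>Both products are components of the smooth connection form on fixed vectors along the
  line \<open>(t, 1, 1)\<close>, and inherit their differentiability from it.\<close>

lemma instanton_differentiable:
  assumes inst: "G2_instanton (inv_conn f g)" and t: "t > 0"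
  shows "\<exists>c. ((\<lambda>t. cA 1 t * f t) has_real_derivative c) (at t)"
    and "\<exists>c. ((\<lambda>t. cA 2 t * g t) has_real_derivative c) (at t)"
proof -
  have diff: "(\<lambda>t. inv_conn f g (t, 1, 1) v) differentiable (at t)" for v
  proof -
    have S: "open {x :: point. fst x > 0}" "Ck_on (Suc 0) {x. fst x > 0} (\<lambda>x. inv_conn f g x v)"
      using inst unfolding G2_instanton_def smooth_form_on_def by blast+
    then have "(\<lambda>x. inv_conn f g x v) differentiable_on {x. fst x > 0}" by simp
    then have "(\<lambda>x. inv_conn f g x v) differentiable (at (t, 1, 1))"
      using t S(1) unfolding differentiable_on_def by (metis at_within_open fst_conv mem_Collect_eq)
    then obtain L where "((\<lambda>x. inv_conn f g x v) has_derivative L) (at (t, 1, 1))"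
      unfolding differentiable_def by blast
    moreover have "((\<lambda>t. (t, 1, 1) :: point) has_derivative (\<lambda>h. (h, 0, 0))) (at t)"
      by (intro has_derivative_Pair has_derivative_ident has_derivative_const)
    ultimately show ?thesis
      unfolding differentiable_def by (intro exI) (rule has_derivative_compose[rotated])
  qed
  have lin: "bounded_linear q1" "bounded_linear q2"
    by (simp_all add: linear_conv_bounded_linear[symmetric] linearI)
  have "(\<lambda>t. cA 1 t * f t) = (\<lambda>t. q1 (inv_conn f g (t, 1, 1) (frame_plus 1)))"
    "(\<lambda>t. cA 2 t * g t) = (\<lambda>t. q2 (inv_conn f g (t, 1, 1) (frame_plus 2)))"
    by (simp_all add: inv_conn_def eta_frame T_sel fun_eq_iff)
  then have "(\<lambda>t. cA 1 t * f t) differentiable (at t)" "(\<lambda>t. cA 2 t * g t) differentiable (at t)"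
    using diff[of "frame_plus 1"] diff[of "frame_plus 2"]
    by (auto simp: differentiable_def intro: bounded_linear.has_derivative[OF lin(1)] bounded_linear.has_derivative[OF lin(2)])
  then show "\<exists>c. ((\<lambda>t. cA 1 t * f t) has_real_derivative c) (at t)"
    "\<exists>c. ((\<lambda>t. cA 2 t * g t) has_real_derivative c) (at t)"
    by (auto simp: real_differentiable_def)
qed


section \<open>The radial variable\<close>

text \<open>In the variable \<open>v = sqrt (r - 9/4)\<close> the integrand defining \<open>t_of_r\<close> becomes smooth.\<close>

definition dt_dv :: "real \<Rightarrow> real" where
  "dt_dv v = 2 * sqrt ((v\<^sup>2 + 3/2) * (v\<^sup>2 + 3) / (v\<^sup>2 + 9/2))"

definition t_of_v :: "real \<Rightarrow> real" where "t_of_v v = integral {0..v} dt_dv"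

lemma dt_dv_ge: "dt_dv v \<ge> 2"
proof -
  have "(v\<^sup>2 + 3/2) * (v\<^sup>2 + 3) / (v\<^sup>2 + 9/2) \<ge> 1"
    by (simp add: field_simps add_pos_nonneg flip: power2_eq_square)
  then show ?thesis by (simp add: dt_dv_def)
qed

lemma dt_dv_cont: "continuous_on S dt_dv"
  unfolding dt_dv_def
  by (intro continuous_intros) (simp add: add_nonneg_pos less_imp_neq[symmetric])

lemma t_of_v_deriv_within:
  "0 \<le> v \<Longrightarrow> v \<le> u \<Longrightarrow> (t_of_v has_real_derivative dt_dv v) (at v within {0..u})"
  unfolding t_of_v_def by (rule integral_has_real_derivative[OF dt_dv_cont]) simp

lemma t_of_v_deriv: "v > 0 \<Longrightarrow> (t_of_v has_real_derivative dt_dv v) (at v)"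
  using t_of_v_deriv_within[of v "v + 1"] by (simp add: at_within_Icc_at)

lemma t_of_v_cont: "continuous_on {0..u} t_of_v"
  by (rule DERIV_continuous_on[OF t_of_v_deriv_within]) auto

lemma t_of_v_0: "t_of_v 0 = 0" by (simp add: t_of_v_def)

text \<open>The derivative is at least 2. This one bound later yields the injectivity of
  \<open>t_of_r\<close>, its surjectivity onto \<open>t >= 0\<close>, and the divergence of
  \<open>r_of_t\<close>.\<close>

lemma t_of_v_diff_ge:
  assumes "0 \<le> u" "u \<le> v"
  shows "t_of_v v - t_of_v u \<ge> 2 * (v - u)"
proof -
  have "t_of_v u - 2 * u \<le> t_of_v v - 2 * v"
  proof (rule DERIV_nonneg_imp_increasing_open[OF \<open>u \<le> v\<close>])
    show "\<exists>y. ((\<lambda>v. t_of_v v - 2 * v) has_real_derivative y) (at w) \<and> 0 \<le> y" if "u < w" for w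
      using that assms dt_dv_ge[of w]
      by (intro exI[of _ "dt_dv w - 2"]) (auto intro!: derivative_eq_intros t_of_v_deriv)
    show "continuous_on {u..v} (\<lambda>v. t_of_v v - 2 * v)"
      by (intro continuous_intros continuous_on_subset[OF t_of_v_cont[of v]]) (use assms in auto)
  qed
  then show ?thesis by simp
qed

text \<open>The square of the coefficient \<open>cA 1\<close> in the variable
  \<open>s = r - 9/4\<close>.\<close>

definition A1sq where "A1sq s = s * (s + 9/2) / ((s + 3/2) * (s + 3 :: real))"

text \<open>With \<open>v = sqrt s\<close> the left side is \<open>dt/dv * dv/ds\<close>, so this
  says \<open>dr/dt = cA 1\<close>.\<close>

lemma dt_dv_sqrt:
  assumes "s > 0"
  shows "dt_dv (sqrt s) * (inverse (sqrt s) / 2) = 1 / sqrt (A1sq s)"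
proof -
  have "2 * (a * b / c) * (inverse d / 2) = 1 / (d * c / (a * b))" for a b c d :: real
    by (simp add: inverse_eq_divide)
  with assms show ?thesis by (simp add: dt_dv_def A1sq_def real_sqrt_mult real_sqrt_divide)
qed

text \<open>The integrand is singular at \<open>9/4\<close>, but the primitive found by the
  substitution is continuous up to that endpoint, so a derivative in the interior is enough.\<close>

lemma t_of_r_eq:
  assumes "s \<ge> 0"
  shows "t_of_r (9/4 + s) = t_of_v (sqrt s)"
proof -
  define h where "h s = sqrt ((s - 3/4) * (s + 3/4)) / sqrt ((s - 9/4) * (s + 9/4))" for s :: real
  have "(h has_integral t_of_v (sqrt (9/4 + s - 9/4)) - t_of_v (sqrt (9/4 - 9/4))) {9/4..9/4 + s}"
  proof (rule fundamental_theorem_of_calculus_interior)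
    show "continuous_on {9/4..9/4 + s} (\<lambda>r. t_of_v (sqrt (r - 9/4)))"
      by (rule continuous_on_compose2[OF t_of_v_cont[of "sqrt s"]]) (auto intro!: continuous_intros)
    fix r :: real assume "r \<in> {9/4<..<9/4 + s}"
    then have r: "r > 9/4" by simp
    have "((\<lambda>r. t_of_v (sqrt (r - 9/4))) has_real_derivative dt_dv (sqrt (r - 9/4)) * (inverse (sqrt (r - 9/4)) / 2)) (at r)"
      by (rule derivative_eq_intros DERIV_chain'[OF _ t_of_v_deriv] refl | use r in simp)+
    moreover have "A1sq (r - 9/4) = ((r - 9/4) * (r + 9/4)) / ((r - 3/4) * (r + 3/4))"
      by (simp add: A1sq_def add.commute)
    then have "dt_dv (sqrt (r - 9/4)) * (inverse (sqrt (r - 9/4)) / 2) = h r"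
      using dt_dv_sqrt[of "r - 9/4"] r by (simp only: h_def real_sqrt_divide) simp
    ultimately show "((\<lambda>r. t_of_v (sqrt (r - 9/4))) has_vector_derivative h r) (at r)"
      by (simp add: has_real_derivative_iff_has_vector_derivative)
  qed (use assms in simp)
  then show ?thesis
    unfolding t_of_r_def h_def using t_of_v_0 by (simp add: integral_unique)
qed

lemma t_of_r_diff_ge:
  assumes "0 \<le> s" "s \<le> u"
  shows "t_of_r (9/4 + u) - t_of_r (9/4 + s) \<ge> 2 * (sqrt u - sqrt s)"
  using t_of_v_diff_ge[of "sqrt s" "sqrt u"] assms by (simp add: t_of_r_eq)

lemma t_of_r_0: "t_of_r (9/4) = 0"
  using t_of_r_eq[of 0] t_of_v_0 by simp

lemma t_of_r_pos: "s > 0 \<Longrightarrow> t_of_r (9/4 + s) > 0"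
  using t_of_r_diff_ge[of 0 s] t_of_r_0 by (smt (verit) real_sqrt_gt_zero real_sqrt_zero add_0_right)

lemma r_of_t_of_r:
  assumes "s \<ge> 0"
  shows "r_of_t (t_of_r (9/4 + s)) = 9/4 + s"
proof -
  have "inj_on t_of_r {9/4..}"
  proof (rule linorder_inj_onI')
    fix a b :: real assume ab: "a \<in> {9/4..}" "b \<in> {9/4..}" "a < b"
    then have "sqrt (b - 9/4) - sqrt (a - 9/4) > 0" by simp
    moreover have "t_of_r b - t_of_r a \<ge> 2 * (sqrt (b - 9/4) - sqrt (a - 9/4))"
      using t_of_r_diff_ge[of "a - 9/4" "b - 9/4"] ab by simp
    ultimately have "t_of_r b - t_of_r a > 0"
      by (meson less_le_trans mult_pos_pos zero_less_numeral)
    then show "t_of_r a \<noteq> t_of_r b" by simp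
  qed
  with assms show ?thesis unfolding r_of_t_def by (intro inv_into_f_f) auto
qed

lemma t_of_r_surj:
  assumes "t \<ge> 0" obtains s where "s \<ge> 0" "t_of_r (9/4 + s) = t"
proof -
  have "t_of_v t \<ge> t" using t_of_v_diff_ge[of 0 t] t_of_v_0 assms by simp
  then obtain v where "v \<ge> 0" "t_of_v v = t"
    using IVT'[of t_of_v 0 t t] t_of_v_0 t_of_v_cont[of t] assms by auto
  with that[of "v\<^sup>2"] show ?thesis by (simp add: t_of_r_eq)
qed

lemma t_of_r_deriv:
  assumes "s > 0"
  shows "((\<lambda>s. t_of_r (9/4 + s)) has_real_derivative 1 / sqrt (A1sq s)) (at s)"
proof -
  have "((\<lambda>s. t_of_v (sqrt s)) has_real_derivative dt_dv (sqrt s) * (inverse (sqrt s) / 2)) (at s)"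
    by (rule derivative_eq_intros DERIV_chain'[OF _ t_of_v_deriv] refl | use assms in simp)+
  note this[unfolded dt_dv_sqrt[OF assms]]
  moreover have "\<forall>\<^sub>F s in nhds s. t_of_r (9/4 + s) = t_of_v (sqrt s)"
    using eventually_nhds_in_open[of "{0<..}" s] assms by (auto elim!: eventually_mono simp: t_of_r_eq)
  ultimately show ?thesis by (simp add: DERIV_cong_ev[OF refl])
qed

text \<open>The limit is \<open>dt_dv 0\<close>, the one-sided derivative of \<open>t_of_v\<close>
  at \<open>0\<close>. It converts the expansions of \<open>f\<close> and \<open>g\<close> in
  \<open>t\<close> into initial values in \<open>s\<close>.\<close>

lemma t_of_r_asymp: "((\<lambda>s. t_of_r (9/4 + s) / sqrt s) \<longlongrightarrow> 2) (at_right 0)"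
proof -
  have "(t_of_v has_real_derivative dt_dv 0) (at 0 within {0..1})"
    by (rule t_of_v_deriv_within) auto
  then have "((\<lambda>v. t_of_v v / v) \<longlongrightarrow> dt_dv 0) (at_right 0)"
    by (simp add: has_field_derivative_iff t_of_v_0 at_within_Icc_at_right)
  moreover have "filterlim sqrt (at_right 0) (at_right (0::real))"
    using tendsto_real_sqrt[OF tendsto_ident_at, of 0 "{0<..}"]
    by (auto simp: filterlim_at eventually_at_right_less[THEN eventually_mono])
  ultimately have "((\<lambda>s. t_of_v (sqrt s) / sqrt s) \<longlongrightarrow> dt_dv 0) (at_right 0)"
    by (rule filterlim_compose)
  moreover have "dt_dv 0 = 2" by (simp add: dt_dv_def)
  moreover have "\<forall>\<^sub>F s in at_right 0. t_of_v (sqrt s) / sqrt s = t_of_r (9/4 + s) / sqrt s"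
    by (auto simp: t_of_r_eq eventually_at_filter)
  ultimately show ?thesis using Lim_transform_eventually by force
qed

lemma r_of_t_at_top: "filterlim (\<lambda>t. r_of_t t - 9/4) at_top at_top"
  unfolding filterlim_at_top
proof safe
  fix Z :: real
  show "\<forall>\<^sub>F t in at_top. Z \<le> r_of_t t - 9/4"
  proof (rule eventually_at_top_linorderI)
    fix t assume t: "t \<ge> t_of_r (9/4 + max Z 0)"
    have "t_of_r (9/4 + max Z 0) \<ge> 0"
      using t_of_r_pos[of "max Z 0"] t_of_r_0 by (cases "max Z 0 = 0") (auto simp: less_imp_le)
    then obtain s where s: "s \<ge> 0" "t_of_r (9/4 + s) = t" using t t_of_r_surj by (metis order_trans)
    have "s \<ge> max Z 0"
    proof (rule ccontr)
      assume "\<not> s \<ge> max Z 0"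
      then have "sqrt s < sqrt (max Z 0)" by (simp only: real_sqrt_less_iff not_le)
      moreover have "t_of_r (9/4 + max Z 0) - t_of_r (9/4 + s) \<ge> 2 * (sqrt (max Z 0) - sqrt s)"
        using \<open>\<not> s \<ge> max Z 0\<close> s by (intro t_of_r_diff_ge) linarith+
      ultimately have "0 < t_of_r (9/4 + max Z 0) - t_of_r (9/4 + s)"
        by (meson less_le_trans mult_pos_pos zero_less_numeral diff_gt_0_iff_gt)
      with s(2) t show False by linarith
    qed
    then show "Z \<le> r_of_t t - 9/4" using r_of_t_of_r[of s] s by simp
  qed
qed

lemma coeffs_at_t_of_r:
  assumes "s > 0"
  defines "t \<equiv> t_of_r (9/4 + s)"
  shows "cA 1 t = sqrt (A1sq s)" "cA 2 t = sqrt (s * (s + 3) / 3)"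
    "cB 1 t = 2 * (s + 9/4) / 3" "cB 2 t = sqrt ((s + 3/2) * (s + 9/2) / 3)"
  using r_of_t_of_r[of s] assms
  by (simp_all add: cA_def cB_def A1sq_def real_sqrt_divide add_ac)


section \<open>A planar system\<close>

lemma nondecreasing_from_0:
  fixes h :: "real \<Rightarrow> real"
  assumes "continuous_on {0..} h" "\<And>s. s > 0 \<Longrightarrow> (h has_real_derivative h' s) (at s)"
    and "\<And>s. s > 0 \<Longrightarrow> h' s \<ge> 0" and "0 \<le> a" "a \<le> b"
  shows "h a \<le> h b"
proof (rule DERIV_nonneg_imp_increasing_open[OF \<open>a \<le> b\<close>])
  show "\<exists>y. (h has_real_derivative y) (at s) \<and> 0 \<le> y" if "a < s" for s
    using assms(2,3)[of s] \<open>0 \<le> a\<close> that by auto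
  show "continuous_on {a..b} h"
    using assms(1) by (rule continuous_on_subset) (use \<open>0 \<le> a\<close> in auto)
qed

text \<open>At \<open>0\<close>, where the instanton equations degenerate, only continuity is
  imposed, and the values there carry the initial data. For an instanton, \<open>x 0 > k 0\<close>
  reads \<open>2 * f1 - 1 > 2 * g1\<close>.\<close>

locale planar_system =
  fixes q x k :: "real \<Rightarrow> real"
  assumes q_nonneg: "s \<ge> 0 \<Longrightarrow> q s \<ge> 0" and q_cont: "continuous_on {0..} q"
    and x_cont: "continuous_on {0..} x" and k_cont: "continuous_on {0..} k"
    and x_deriv: "s > 0 \<Longrightarrow> (x has_real_derivative - (k s)\<^sup>2) (at s)"
    and k_deriv: "s > 0 \<Longrightarrow> (k has_real_derivative - k s * (x s + q s)) (at s)"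
    and k_0: "k 0 > 0" and x_0: "x 0 > k 0"
begin

text \<open>The equation for \<open>k\<close> is linear once \<open>x\<close> is given:
  \<open>k * exp I\<close> is constant for a primitive \<open>I\<close> of
  \<open>x + q\<close>.\<close>

lemma k_pos:
  assumes "s \<ge> 0"
  shows "k s > 0"
proof -
  define I where "I u = integral {0..u} (\<lambda>v. x v + q v)" for u
  have cont: "continuous_on {0..u} (\<lambda>v. x v + q v)" for u
    by (intro continuous_intros continuous_on_subset[OF x_cont] continuous_on_subset[OF q_cont]) auto
  have I_cont: "continuous_on {0..u} I" for u
    unfolding I_def by (intro indefinite_integral_continuous_1 integrable_continuous_real cont)
  have I_deriv: "(I has_real_derivative x u + q u) (at u)" if "u > 0" for u
  proof -
    have "(I has_real_derivative x u + q u) (at u within {0..u + 1})"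
      unfolding I_def by (rule integral_has_real_derivative[OF cont]) (use that in auto)
    then show ?thesis using that by (simp add: at_within_Icc_at)
  qed
  have "k s * exp (I s) = k 0 * exp (I 0)"
  proof (cases "s = 0")
    case False
    show ?thesis
      by (rule DERIV_isconst_end[of 0 s "\<lambda>u. k u * exp (I u)"])
        (use False \<open>s \<ge> 0\<close> in \<open>auto intro!: continuous_intros continuous_on_subset[OF k_cont] I_cont
          derivative_eq_intros k_deriv I_deriv simp: algebra_simps\<close>)
  qed simp
  with k_0 have "k s * exp (I s) > 0" by simp
  then show ?thesis by (simp add: zero_less_mult_iff)
qed

text \<open>The difference of squares is conserved when \<open>q = 0\<close>; a nonnegative
  \<open>q\<close> can only increase it.\<close>

lemma energy: "0 \<le> s \<Longrightarrow> (x 0)\<^sup>2 - (k 0)\<^sup>2 \<le> (x s)\<^sup>2 - (k s)\<^sup>2"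
proof (rule nondecreasing_from_0[where h = "\<lambda>s. (x s)\<^sup>2 - (k s)\<^sup>2" and h' = "\<lambda>s. 2 * q s * (k s)\<^sup>2"])
  show "((\<lambda>s. (x s)\<^sup>2 - (k s)\<^sup>2) has_real_derivative 2 * q s * (k s)\<^sup>2) (at s)" if "s > 0" for s
    by (rule derivative_eq_intros x_deriv k_deriv refl that)+
      (simp add: power2_eq_square algebra_simps)
qed (auto intro!: continuous_intros x_cont k_cont simp: q_nonneg)

text \<open>By \<open>energy\<close> the square of \<open>x\<close> never drops below
  \<open>c\<^sup>2\<close>, so \<open>x\<close> cannot pass through zero and keeps the sign of
  \<open>x 0\<close>.\<close>

lemma x_lower:
  assumes "s \<ge> 0" "c > 0" "c\<^sup>2 \<le> (x 0)\<^sup>2 - (k 0)\<^sup>2"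
  shows "x s \<ge> c"
proof (rule ccontr)
  have sq: "c\<^sup>2 \<le> (x u)\<^sup>2" if "u \<ge> 0" for u
    using energy[OF that] assms(3) by (smt (verit) zero_le_power2)
  assume "\<not> c \<le> x s"
  with sq[OF \<open>s \<ge> 0\<close>] \<open>c > 0\<close> have "x s \<le> 0"
    using power2_le_iff_abs_le[of "x s" c] abs_le_square_iff[of c "x s"] by (auto simp: abs_if split: if_splits)
  moreover have "x 0 > 0" using x_0 k_0 by simp
  ultimately obtain u where "0 \<le> u" "x u = 0"
    using IVT2'[of x s 0 0] \<open>s \<ge> 0\<close> continuous_on_subset[OF x_cont, of "{0..s}"] by auto
  with sq[of u] \<open>c > 0\<close> show False by simp
qed

text \<open>The logarithmic derivative of \<open>k\<close> is \<open>- (x + q)\<close>, which is at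
  most \<open>- c\<close>.\<close>

lemma k_upper:
  assumes "s \<ge> 0" "c > 0" "c\<^sup>2 \<le> (x 0)\<^sup>2 - (k 0)\<^sup>2"
  shows "k s \<le> k 0 * exp (- c * s)"
proof -
  have "- (k 0 * exp (c * 0)) \<le> - (k s * exp (c * s))"
  proof (rule nondecreasing_from_0[where h = "\<lambda>s. - (k s * exp (c * s))"
        and h' = "\<lambda>s. k s * (x s - c + q s) * exp (c * s)"])
    show "k s * (x s - c + q s) * exp (c * s) \<ge> 0" if "s > 0" for s
      using k_pos[of s] x_lower[OF _ assms(2,3), of s] q_nonneg[of s] that by simp
  qed (use assms in \<open>auto intro!: continuous_intros k_cont derivative_eq_intros k_deriv
      simp: algebra_simps\<close>)
  then show ?thesis by (simp add: exp_minus field_simps)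
qed

lemma antimono_x: "0 \<le> a \<Longrightarrow> a \<le> b \<Longrightarrow> x b \<le> x a"
  using nondecreasing_from_0[where h = "\<lambda>s. - x s" and h' = "\<lambda>s. (k s)\<^sup>2"]
  by (force intro!: continuous_intros x_cont derivative_eq_intros x_deriv)

definition x_inf :: real where "x_inf = (INF s\<in>{0..}. x s)"

lemma x_tendsto: "(x \<longlongrightarrow> x_inf) at_top"
proof -
  define c where "c = sqrt ((x 0)\<^sup>2 - (k 0)\<^sup>2)"
  have "(k 0)\<^sup>2 < (x 0)\<^sup>2" using x_0 k_0 by (simp add: power_strict_mono)
  then have c: "c > 0" "c\<^sup>2 \<le> (x 0)\<^sup>2 - (k 0)\<^sup>2" by (auto simp: c_def)
  have bdd: "bdd_below (x ` {0..})" using x_lower[OF _ c] by (intro bdd_belowI2[of _ c]) auto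
  show ?thesis
  proof (rule order_tendstoI)
    fix a assume "a < x_inf"
    moreover have "x_inf \<le> x s" if "s \<ge> 0" for s
      unfolding x_inf_def using bdd that by (auto intro: cINF_lower)
    ultimately show "\<forall>\<^sub>F s in at_top. a < x s"
      by (intro eventually_at_top_linorderI[of 0]) (auto intro: less_le_trans)
  next
    fix a assume "x_inf < a"
    then obtain s0 where "s0 \<ge> 0" "x s0 < a"
      unfolding x_inf_def using cInf_lessD[of "x ` {0..}" a] by auto
    then show "\<forall>\<^sub>F s in at_top. x s < a"
      using antimono_x by (intro eventually_at_top_linorderI[of s0]) (auto intro: le_less_trans)
  qed
qed

lemma x_inf_lower:
  assumes "c > 0" "c\<^sup>2 \<le> (x 0)\<^sup>2 - (k 0)\<^sup>2"
  shows "x_inf \<ge> c"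
  by (rule tendsto_lowerbound[OF x_tendsto])
    (use x_lower[OF _ assms] in \<open>auto intro!: eventually_at_top_linorderI[of 0]\<close>)

end

section \<open>Comparison of two solutions with the same \<open>k 0\<close> (fixed
  \<open>g1\<close>, two values of \<open>f1\<close>)\<close>

locale planar_pair = a: planar_system q xa ka + b: planar_system q xb kb
  for q xa ka xb kb +
  assumes k_eq: "kb 0 = ka 0" and x_less: "xa 0 < xb 0"
begin

definition D where "D s = xb s - xa s"
definition L where "L s = ln (ka s) - ln (kb s)"

lemma D_cont: "continuous_on {0..} D"
  unfolding D_def by (intro continuous_intros a.x_cont b.x_cont)

lemma L_cont: "continuous_on {0..} L"
  unfolding L_def
  by (intro continuous_intros a.k_cont b.k_cont) (use a.k_pos b.k_pos in force)+

lemma L_0: "L 0 = 0" by (simp add: L_def k_eq)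
lemma D_0: "D 0 > 0" using x_less by (simp add: D_def)

text \<open>The term \<open>q\<close> is common to both logarithmic derivatives and cancels.
  Together with \<open>D_deriv\<close> this closes the system in \<open>D\<close> and
  \<open>L\<close>.\<close>

lemma L_deriv: "s > 0 \<Longrightarrow> (L has_real_derivative D s) (at s)"
  unfolding L_def D_def
  by (rule derivative_eq_intros a.k_deriv b.k_deriv refl a.k_pos b.k_pos | simp)+
    (use a.k_pos[of s] b.k_pos[of s] in \<open>simp add: field_simps\<close>)

lemma kb_eq: "s \<ge> 0 \<Longrightarrow> kb s = ka s * exp (- L s)"
  using a.k_pos[of s] b.k_pos[of s] by (simp add: L_def exp_diff)

lemma D_deriv: "s > 0 \<Longrightarrow> (D has_real_derivative (ka s)\<^sup>2 * (1 - exp (- 2 * L s))) (at s)"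
  unfolding D_def
  by (rule derivative_eq_intros a.x_deriv b.x_deriv refl | simp)+
    (simp add: kb_eq power_mult_distrib exp_double[symmetric] algebra_simps flip: exp_of_nat_mult)

text \<open>Before a first zero of \<open>D\<close> the function \<open>L\<close> increases from
  \<open>0\<close>, so \<open>D' >= 0\<close> there, and \<open>D\<close> could not have come down
  from \<open>D 0 > 0\<close>.\<close>

lemma D_pos:
  assumes "s \<ge> 0"
  shows "D s > 0"
proof (rule ccontr)
  assume "\<not> D s > 0"
  define Z where "Z = {u \<in> {0..s}. D u = 0}"
  have "Z \<noteq> {}"
    using IVT2'[of D s 0 0] assms D_0 \<open>\<not> D s > 0\<close> continuous_on_subset[OF D_cont, of "{0..s}"]
    by (auto simp: Z_def)
  moreover have "closed Z"
    unfolding Z_def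
    by (rule continuous_closed_preimage_constant[OF continuous_on_subset[OF D_cont]]) auto
  moreover have bdd: "bdd_below Z" by (auto simp: Z_def)
  ultimately have z: "Inf Z \<in> Z" by (intro closed_contains_Inf)
  \<comment> \<open>The first zero of \<open>D\<close>; it belongs to \<open>Z\<close> because
    \<open>Z\<close> is closed.\<close>
  define z where "z = Inf Z"
  have z0: "z > 0" "D z = 0" using z D_0 by (auto simp: Z_def z_def less_le)
  have Dpos: "D u > 0" if u: "0 \<le> u" "u < z" for u
  proof (rule ccontr)
    assume "\<not> D u > 0"
    then obtain w where "0 \<le> w" "w \<le> u" "D w = 0"
      using IVT2'[of D u 0 0] u D_0 continuous_on_subset[OF D_cont, of "{0..u}"] by auto
    with u z have "w \<in> Z" by (auto simp: Z_def z_def)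
    with cInf_lower[OF this bdd] \<open>w \<le> u\<close> u show False by (simp add: z_def)
  qed
  have Lnn: "L u \<ge> 0" if "0 \<le> u" "u < z" for u
  proof -
    have "L 0 \<le> L u"
    proof (rule DERIV_nonneg_imp_increasing_open[OF that(1)])
      show "\<exists>y. (L has_real_derivative y) (at w) \<and> 0 \<le> y" if "0 < w" "w < u" for w
        using L_deriv[of w] Dpos[of w] \<open>u < z\<close> that by (intro exI[of _ "D w"]) simp
      show "continuous_on {0..u} L" using L_cont by (rule continuous_on_subset) auto
    qed
    with L_0 show ?thesis by simp
  qed
  have "D 0 \<le> D z"
  proof (rule DERIV_nonneg_imp_increasing_open[where f = D])
    show "\<exists>y. (D has_real_derivative y) (at w) \<and> 0 \<le> y" if "0 < w" "w < z" for w
      using D_deriv[of w] Lnn[of w] that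
      by (intro exI[of _ "(ka w)\<^sup>2 * (1 - exp (- 2 * L w))"]) simp
    show "continuous_on {0..z} D" using D_cont by (rule continuous_on_subset) auto
  qed (use z0 in simp)
  with z0 D_0 show False by simp
qed

lemma L_nonneg: "s \<ge> 0 \<Longrightarrow> L s \<ge> 0"
  using nondecreasing_from_0[OF L_cont L_deriv, of 0 s] D_pos L_0 by (auto intro: less_imp_le)

lemma D_mono: "0 \<le> s \<Longrightarrow> s \<le> u \<Longrightarrow> D s \<le> D u"
  by (rule nondecreasing_from_0[OF D_cont D_deriv]) (use L_nonneg in auto)

text \<open>By the mean value theorem \<open>L s\<close> is \<open>s\<close> times an earlier value
  of \<open>D\<close>, and \<open>D\<close> is nondecreasing.\<close>

lemma L_le:
  assumes "s \<ge> 0" shows "L s \<le> s * D s"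
proof (cases "s = 0")
  case False
  with assms obtain l z where "0 < z" "z < s" "(L has_real_derivative l) (at z)" "L s - L 0 = (s - 0) * l"
    using MVT[of 0 s L] continuous_on_subset[OF L_cont, of "{0..s}"] L_deriv
    by (force simp: real_differentiable_def)
  moreover from this have "l = D z" using DERIV_unique L_deriv by blast
  ultimately show ?thesis using L_0 D_mono[of z s] by simp
qed (simp add: L_0)

text \<open>A Gronwall argument: \<open>D' <= M' * D\<close> with \<open>M' s\<close> proportional
  to \<open>s * exp (- 2 * c * s)\<close>. The integral of \<open>M'\<close> over the half-line is
  \<open>(ka 0)\<^sup>2 / (2 * c\<^sup>2)\<close>, so the bound on \<open>D\<close> survives the
  limit.\<close>

lemma x_inf_Lipschitz:
  assumes c: "c > 0" "c\<^sup>2 \<le> (xa 0)\<^sup>2 - (ka 0)\<^sup>2"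
  shows "a.x_inf \<le> b.x_inf" "b.x_inf - a.x_inf \<le> exp ((ka 0)\<^sup>2 / (2 * c\<^sup>2)) * (xb 0 - xa 0)"
proof -
  have lim: "(D \<longlongrightarrow> b.x_inf - a.x_inf) at_top"
    unfolding D_def by (intro tendsto_intros a.x_tendsto b.x_tendsto)
  have "0 \<le> b.x_inf - a.x_inf"
    by (rule tendsto_lowerbound[OF lim]) (use D_pos in \<open>auto intro!: eventually_at_top_linorderI[of 0] less_imp_le\<close>)
  then show "a.x_inf \<le> b.x_inf" by simp
  \<comment> \<open>\<open>M\<close> is the primitive of \<open>M'\<close> that vanishes at infinity, so \<open>D' \<le> M' D\<close> bounds \<open>D\<close> by
    \<open>exp (- M 0) * D 0\<close>.\<close>
  define M where "M s = - (ka 0)\<^sup>2 * (s / c + 1 / (2 * c\<^sup>2)) * exp (- 2 * c * s)" for s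
  define M' where "M' s = 2 * (ka 0)\<^sup>2 * s * exp (- 2 * c * s)" for s
  have M_deriv: "(M has_real_derivative M' s) (at s)" for s
  proof -
    define a b where "a = 1 / c" and "b = 1 / (2 * c\<^sup>2)"
    have ab: "a * c = 1" "2 * b * c = a" using \<open>c > 0\<close> by (simp_all add: a_def b_def power2_eq_square)
    have M: "M = (\<lambda>s. - (ka 0)\<^sup>2 * (s * a + b) * exp (- 2 * c * s))"
      by (simp add: M_def a_def b_def fun_eq_iff)
    have "(M has_real_derivative (ka 0)\<^sup>2 * exp (- 2 * c * s) * (2 * (s * (a * c)) + 2 * b * c - a)) (at s)"
      unfolding M       by (rule DERIV_cong[OF DERIV_mult[OF DERIV_cmult[OF DERIV_add[OF DERIV_cmult_right[OF DERIV_ident] DERIV_const]]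
            DERIV_chain'[OF DERIV_cmult[OF DERIV_ident] DERIV_exp]]]) algebra
    then show ?thesis by (simp only: ab M'_def) (simp add: mult_ac)
  qed
  have D'_le: "(ka s)\<^sup>2 * (1 - exp (- 2 * L s)) \<le> M' s * D s" if "s > 0" for s
  proof -
    have "(ka s)\<^sup>2 * (1 - exp (- 2 * L s)) \<le> (ka 0 * exp (- c * s))\<^sup>2 * (2 * (s * D s))"
    proof (intro mult_mono power_mono)
      show "ka s \<le> ka 0 * exp (- c * s)" using a.k_upper[OF _ c] that by simp
      show "1 - exp (- 2 * L s) \<le> 2 * (s * D s)"
        using L_le[of s] exp_ge_add_one_self[of "- 2 * L s"] that by simp
    qed (use a.k_pos[of s] L_nonneg[of s] that in auto)
    then show ?thesis
      by (simp add: M'_def power_mult_distrib mult_ac flip: exp_of_nat_mult)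
  qed
  have bound: "D s \<le> exp ((ka 0)\<^sup>2 / (2 * c\<^sup>2)) * D 0" if "s \<ge> 0" for s
  proof -
    have "- (D 0 * exp (- M 0)) \<le> - (D s * exp (- M s))"
    proof (rule nondecreasing_from_0[where h = "\<lambda>s. - (D s * exp (- M s))"
          and h' = "\<lambda>s. (M' s * D s - (ka s)\<^sup>2 * (1 - exp (- 2 * L s))) * exp (- M s)"])
      show "((\<lambda>s. - (D s * exp (- M s))) has_real_derivative
          (M' s * D s - (ka s)\<^sup>2 * (1 - exp (- 2 * L s))) * exp (- M s)) (at s)" if "s > 0" for s
        using DERIV_minus[OF DERIV_mult[OF D_deriv[OF that] DERIV_chain'[OF DERIV_minus[OF M_deriv] DERIV_exp]]]
        by (rule DERIV_cong) (simp only: ring_distribs minus_mult_left minus_mult_right minus_diff_eq diff_minus_eq_add mult_ac add_ac diff_conv_add_uminus minus_minus minus_add_distrib)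
      show "0 \<le> (M' s * D s - (ka s)\<^sup>2 * (1 - exp (- 2 * L s))) * exp (- M s)" if "s > 0" for s
        using D'_le[OF that] by (intro mult_nonneg_nonneg) simp_all
      show "continuous_on {0..} (\<lambda>s. - (D s * exp (- M s)))"
        by (intro continuous_intros D_cont DERIV_continuous_on[OF has_field_derivative_at_within[OF M_deriv]])
    qed (use that in auto)
    moreover have "exp (- M s) \<ge> 1"
      using \<open>c > 0\<close> that by (simp add: M_def)
    then have "D s \<le> D s * exp (- M s)" using D_pos[OF that] by simp
    moreover have "- M 0 = (ka 0)\<^sup>2 / (2 * c\<^sup>2)" by (simp add: M_def)
    ultimately show ?thesis by (simp add: mult.commute)
  qed
  show "b.x_inf - a.x_inf \<le> exp ((ka 0)\<^sup>2 / (2 * c\<^sup>2)) * (xb 0 - xa 0)"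
    unfolding D_def[of 0, symmetric]
    by (rule tendsto_upperbound[OF lim]) (use bound in \<open>auto intro!: eventually_at_top_linorderI[of 0]\<close>)
qed

end


section \<open>Holonomy at infinity\<close>

text \<open>The function \<open>q\<close> of the planar system: the partial fractions left in the
  logarithmic derivative of \<open>conn_k\<close> after the poles at \<open>s = 0\<close>
  cancel.\<close>

definition damping :: "real \<Rightarrow> real" where
  "damping s = (5/2) / (s + 9/2) + (1/2) / (s + 9/4) - (1/2) / (s + 3/2)"

text \<open>Over the common denominator the numerator is
  \<open>5 * s\<^sup>2 + 18 * s + 27/2\<close>, whose coefficients are all positive.\<close>

lemma damping_nonneg: "s \<ge> 0 \<Longrightarrow> damping s \<ge> 0"
proof -
  assume s: "s \<ge> 0"
  define x y z where "x = s + 9/2" and "y = s + 9/4" and "z = s + 3/2"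
  have pos: "x > 0" "y > 0" "z > 0" using s by (simp_all add: x_def y_def z_def)
  have "5 * (y * z) + x * z - x * y = 5 * s\<^sup>2 + 18 * s + 27/2"
    by (simp add: x_def y_def z_def power2_eq_square field_simps)
  then have "5 * (y * z) + x * z - x * y \<ge> 0" using s by simp
  moreover have "damping s = (5 * (y * z) + x * z - x * y) / (2 * x * y * z)"
    unfolding damping_def x_def[symmetric] y_def[symmetric] z_def[symmetric] using pos
    by (simp add: field_simps)
  ultimately show ?thesis using pos by simp
qed

text \<open>Chosen so that the quadratic term in the equation for \<open>conn_x\<close> becomes
  exactly \<open>- (conn_k s)\<^sup>2\<close>; its value at \<open>0\<close> is
  \<open>1\<close>.\<close>

definition k_scale :: "real \<Rightarrow> real" where "k_scale s = sqrt (3 * (s + 3/2) / (s + 9/2))"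

lemma A1sq_pos: "s > 0 \<Longrightarrow> A1sq s > 0" by (simp add: A1sq_def)

lemma eventually_nhds_pos: "(s :: real) > 0 \<Longrightarrow> \<forall>\<^sub>F u in nhds s. u > 0"
  using eventually_nhds_in_open[of "{0<..}" s] by simp

text \<open>The identity \<open>(s + 3/2) * (s + 3) = s * (s + 9/2) + 9/2\<close> turns
  \<open>1 / A1sq s\<close> into a constant plus a multiple of one reciprocal.\<close>

lemma inverse_A1sq_deriv:
  assumes s: "s > 0"
  shows "((\<lambda>s. 1 / A1sq s) has_real_derivative - (9 * (s + 9/4)) / (s * (s + 9/2))\<^sup>2) (at s)"
proof -
  have "((\<lambda>s. s * (s + 9/2)) has_real_derivative 2 * (s + 9/4)) (at s)"
    by (auto intro!: derivative_eq_intros)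
  moreover have "s * (s + 9/2) \<noteq> 0" using s by simp
  ultimately have "((\<lambda>s. 1 + 9/2 * inverse (s * (s + 9/2))) has_real_derivative
      0 + 9/2 * - (inverse (s * (s + 9/2)) * (2 * (s + 9/4)) * inverse (s * (s + 9/2)))) (at s)"
    by (intro DERIV_add DERIV_const DERIV_cmult DERIV_inverse')
  moreover have "0 + 9/2 * - (inverse p * (2 * m) * inverse p) = - (9 * m) / p\<^sup>2" for m p :: real
    by (cases "p = 0") (simp_all add: field_simps power2_eq_square)
  ultimately have "((\<lambda>s. 1 + 9/2 * inverse (s * (s + 9/2))) has_real_derivative
      - (9 * (s + 9/4)) / (s * (s + 9/2))\<^sup>2) (at s)"
    by (simp only:)
  moreover have "1 / A1sq u = 1 + 9/2 * inverse (u * (u + 9/2))" if "u > 0" for u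
  proof -
    have "(u + 3/2) * (u + 3) = u * (u + 9/2) + 9/2" by (simp add: field_simps)
    with that show ?thesis by (simp add: A1sq_def add_divide_distrib inverse_eq_divide)
  qed
  then have "\<forall>\<^sub>F u in nhds s. 1 / A1sq u = 1 + 9/2 * inverse (u * (u + 9/2))"
    using eventually_nhds_pos[OF s] by (rule eventually_mono[rotated])
  ultimately show ?thesis by (simp only: DERIV_cong_ev[OF refl])
qed

lemma continuous_on_from_0:
  fixes h :: "real \<Rightarrow> real"
  assumes "\<And>s. s > 0 \<Longrightarrow> \<exists>d. (h has_real_derivative d) (at s)" "(h \<longlongrightarrow> h 0) (at_right 0)"
  shows "continuous_on {0..} h"
  unfolding continuous_on_eq_continuous_within
proof
  fix s :: real assume "s \<in> {0..}"
  show "continuous (at s within {0..}) h"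
  proof (cases "s = 0")
    case True
    have "at 0 within {0..} = at_right (0::real)"
      by (rule at_within_nhd[of _ UNIV]) auto
    with True assms(2) show ?thesis by (simp add: continuous_within)
  next
    case False
    with \<open>s \<in> {0..}\<close> assms(1)[of s] show ?thesis
      by (auto intro: continuous_at_imp_continuous_at_within DERIV_isCont)
  qed
qed

section \<open>From an instanton to the planar system\<close>

locale instanton =
  fixes f g :: "real \<Rightarrow> real" and f1 g1 :: real
  assumes inst: "G2_instanton (inv_conn f g)"
    and f_init: "(\<lambda>t. f t - f1 * t) \<in> O[at_right 0](\<lambda>t. t ^ 3)"
    and g_init: "(\<lambda>t. g t - g1 * t) \<in> O[at_right 0](\<lambda>t. t ^ 3)"
    and g1_pos: "g1 > 0" and f1_large: "f1 > 1/2 + g1"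
begin

definition tau where "tau s = t_of_r (9/4 + s)"

text \<open>The values at \<open>0\<close> are the limits there, since \<open>A\<^sub>1\<close> and \<open>A\<^sub>2\<close> are asymptotic to \<open>t/2\<close>.\<close>

definition conn_x where "conn_x s = (if s = 0 then 2 * f1 - 1 else cA 1 (tau s) * f (tau s) / A1sq s - 1)"
definition conn_k where "conn_k s = (if s = 0 then 2 * g1 else k_scale s * (cA 2 (tau s) * g (tau s)) / s)"

lemma tau_pos: "s > 0 \<Longrightarrow> tau s > 0" by (simp add: tau_def t_of_r_pos)

lemma tau_deriv: "s > 0 \<Longrightarrow> (tau has_real_derivative 1 / sqrt (A1sq s)) (at s)"
  using t_of_r_deriv[of s] by (simp add: tau_def[abs_def])

text \<open>Passing from \<open>t\<close> to \<open>s\<close> divides by \<open>cA 1\<close>, and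
  this removes the square roots: both right-hand sides are rational in \<open>s\<close>,
  \<open>F\<close> and \<open>G\<close>.\<close>

lemma
  assumes s: "s > 0"
  defines "F \<equiv> cA 1 (tau s) * f (tau s)" and "G \<equiv> cA 2 (tau s) * g (tau s)"
  shows F_deriv: "((\<lambda>s. cA 1 (tau s) * f (tau s)) has_real_derivative
      3 * (F - G\<^sup>2) / (s * (s + 3)) - 3 * F / ((s + 3/2) * (s + 9/2))) (at s)"
    and G_deriv: "((\<lambda>s. cA 2 (tau s) * g (tau s)) has_real_derivative
      G * (1 - F) / A1sq s - 3 * G * (s + 3) / (2 * (s + 9/4) * (s + 9/2))) (at s)"
proof -
  define a where "a = sqrt (A1sq s)"
  have a: "a > 0" "a\<^sup>2 = A1sq s" using A1sq_pos[OF s] by (simp_all add: a_def)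
  obtain c1 c2 where c: "((\<lambda>t. cA 1 t * f t) has_real_derivative c1) (at (tau s))"
     "((\<lambda>t. cA 2 t * g t) has_real_derivative c2) (at (tau s))"
    using instanton_differentiable[OF inst tau_pos[OF s]] by auto
  note ode = instanton_ode[OF inst tau_pos[OF s] c, folded F_def G_def]
  have co: "cA 1 (tau s) = a" "cA 2 (tau s) = sqrt (s * (s + 3) / 3)"
    "cB 1 (tau s) = 2 * (s + 9/4) / 3" "cB 2 (tau s) = sqrt ((s + 3/2) * (s + 9/2) / 3)"
    using coeffs_at_t_of_r[OF s] by (simp_all add: tau_def a_def)
  define u where "u = cA 2 (tau s)"
  define w where "w = cB 2 (tau s)"
  have u: "u > 0" "u\<^sup>2 = s * (s + 3) / 3" and w: "w > 0" "w\<^sup>2 = (s + 3/2) * (s + 9/2) / 3"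
    using s by (simp_all add: u_def w_def co)
  have "c1 / a = (F - G\<^sup>2) / u\<^sup>2 - F / w\<^sup>2"
  proof -
    have "c1 * (u * w)\<^sup>2 = a * w\<^sup>2 * (F - G\<^sup>2) - a * u\<^sup>2 * F"
      using ode(1) unfolding co(1) u_def[symmetric] w_def[symmetric] .
    with a(1) u(1) w(1) show ?thesis
      by (simp add: field_simps power2_eq_square)
  qed
  then have c1: "c1 * (1 / a) = 3 * (F - G\<^sup>2) / (s * (s + 3)) - 3 * F / ((s + 3/2) * (s + 9/2))"
    by (simp add: u w mult.commute)
  show "((\<lambda>s. cA 1 (tau s) * f (tau s)) has_real_derivative
      3 * (F - G\<^sup>2) / (s * (s + 3)) - 3 * F / ((s + 3/2) * (s + 9/2))) (at s)"
    using DERIV_chain2[OF c(1) tau_deriv[OF s]] unfolding a_def[symmetric] c1 .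
  \<comment> \<open>This relation between \<open>cA 2\<close>, \<open>cA 1\<close> and
    \<open>cB 2\<close> removes the roots that remain in the second equation.\<close>
  have uw: "u = a * w * ((s + 3) / (s + 9/2))"
  proof -
    have "u\<^sup>2 = (a * w * ((s + 3) / (s + 9/2)))\<^sup>2"
      unfolding power_mult_distrib power_divide u w a A1sq_def using s
      by (simp add: power2_eq_square divide_simps)
    then show ?thesis using u(1) w(1) a(1) s by (subst (asm) power2_eq_iff_nonneg) auto
  qed
  have B1: "cB 1 (tau s) > 0" using s co(3) by simp
  have "c2 / a = G * (1 - F) / a\<^sup>2 - G * (u / (a * w)) / cB 1 (tau s)"
  proof -
    have "c2 * (a * cB 1 (tau s) * u * w) = u * cB 1 (tau s) * w * G * (1 - F) - a * u\<^sup>2 * G"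
      using ode(2) unfolding co(1) u_def[symmetric] w_def[symmetric] .
    then have "u * (c2 * (a * cB 1 (tau s) * w)) = u * (cB 1 (tau s) * w * G * (1 - F) - a * u * G)"
      by (simp add: power2_eq_square algebra_simps)
    then have "c2 * (a * cB 1 (tau s) * w) = cB 1 (tau s) * w * G * (1 - F) - a * u * G"
      using u(1) by simp
    then have "c2 = (cB 1 (tau s) * w * G * (1 - F) - a * u * G) / (a * cB 1 (tau s) * w)"
      using a(1) w(1) B1 by (simp add: nonzero_eq_divide_eq)
    with a(1) w(1) B1 show ?thesis
      by (simp add: diff_divide_distrib power2_eq_square mult_ac)
  qed
  moreover have "u / (a * w) = (s + 3) / (s + 9/2)" using uw a(1) w(1) by simp
  moreover have frac: "G * (p / x) / (2 * y / 3) = 3 * G * p / (2 * y * x)" for p x y :: real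
    by (simp add: mult_ac)
  ultimately have c2: "c2 * (1 / a) = G * (1 - F) / A1sq s - 3 * G * (s + 3) / (2 * (s + 9/4) * (s + 9/2))"
    using frac[of "s + 3" "s + 9/2" "s + 9/4"] by (simp only: co(3) a(2) mult_1_right times_divide_eq_right[of c2 1])
  show "((\<lambda>s. cA 2 (tau s) * g (tau s)) has_real_derivative
      G * (1 - F) / A1sq s - 3 * G * (s + 3) / (2 * (s + 9/4) * (s + 9/2))) (at s)"
    using DERIV_chain2[OF c(2) tau_deriv[OF s]] unfolding a_def[symmetric] c2 .
qed

text \<open>\<open>1 / A1sq\<close> is an integrating factor: its derivative cancels all terms
  linear in \<open>F\<close>, and only the one in \<open>G\<^sup>2\<close> remains.\<close>

lemma conn_x_deriv:
  assumes s: "s > 0"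
  shows "(conn_x has_real_derivative - (conn_k s)\<^sup>2) (at s)"
proof -
  define F where "F s = cA 1 (tau s) * f (tau s)" for s
  define G where "G = cA 2 (tau s) * g (tau s)"
  define x y z where "x = s + 9/2" and "y = s + 3" and "z = s + 3/2"
  have pos: "x > 0" "y > 0" "z > 0" using s by (simp_all add: x_def y_def z_def)
  have zx: "9 * (s + 9/4) = 3 * (z * x - s * y)" by (simp add: x_def y_def z_def field_simps)
  have "(3 * (F s - G\<^sup>2) / (s * y) - 3 * F s / (z * x)) * (1 / A1sq s)
      + - (3 * (z * x - s * y)) / (s * x)\<^sup>2 * F s = - (3 * z / x * G\<^sup>2 / s\<^sup>2)"
    unfolding A1sq_def x_def[symmetric] y_def[symmetric] z_def[symmetric]
    using s pos by (simp add: field_simps power2_eq_square)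
  from DERIV_add[OF DERIV_mult[OF F_deriv[OF s, folded F_def G_def] inverse_A1sq_deriv[OF s], folded x_def y_def z_def, unfolded zx this] DERIV_const[of "-1"]]
  have "((\<lambda>s. F s * (1 / A1sq s) + - 1) has_real_derivative - (3 * z / x * G\<^sup>2 / s\<^sup>2)) (at s)"
    by simp
  moreover have "(conn_k s)\<^sup>2 = 3 * z / x * G\<^sup>2 / s\<^sup>2"
    using s by (simp add: conn_k_def k_scale_def G_def x_def z_def power_mult_distrib power_divide)
  moreover have "\<forall>\<^sub>F s in nhds s. conn_x s = F s * (1 / A1sq s) + - 1"
    using eventually_nhds_pos[OF s] by (rule eventually_mono) (simp add: conn_x_def F_def)
  ultimately show ?thesis by (simp only: DERIV_cong_ev[OF refl])
qed

text \<open>The logarithmic derivatives of \<open>k_scale\<close>, \<open>G\<close> and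
  \<open>1/s\<close> are added in partial fractions. The \<open>1/s\<close> contained in
  \<open>1 / A1sq s\<close> cancels the one from the division by \<open>s\<close>.\<close>

lemma conn_k_deriv:
  assumes s: "s > 0"
  shows "(conn_k has_real_derivative - conn_k s * (conn_x s + damping s)) (at s)"
proof -
  define F where "F = cA 1 (tau s) * f (tau s)"
  define G where "G s = cA 2 (tau s) * g (tau s)" for s
  define x w y z where "x = s + 9/2" and "w = s + 9/4" and "y = s + 3" and "z = s + 3/2"
  have pos: "x > 0" "w > 0" "y > 0" "z > 0" using s by (simp_all add: x_def w_def y_def z_def)
  have P: "(k_scale has_real_derivative k_scale s * ((1/2) / z - (1/2) / x)) (at s)"
  proof -
    have "((\<lambda>s. 3 * (s + 3/2) / (s + 9/2)) has_real_derivative (3 * x - 3 * z * 1) / (x * x)) (at s)"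
      unfolding x_def z_def using s by (auto intro!: derivative_eq_intros)
    moreover have "3 * z / x > 0" using pos by simp
    ultimately have "(k_scale has_real_derivative (3 * x - 3 * z * 1) / (x * x) * (inverse (k_scale s) / 2)) (at s)"
      unfolding k_scale_def[abs_def] using DERIV_chain2[OF DERIV_real_sqrt]
      by (force simp: x_def z_def mult.commute)
    moreover have "(3 * x - 3 * z * 1) / (x * x) = (k_scale s)\<^sup>2 * (1 / z - 1 / x)"
      using pos by (simp add: k_scale_def x_def[symmetric] z_def[symmetric] field_simps)
    moreover have "k_scale s \<noteq> 0" using pos by (simp add: k_scale_def x_def[symmetric] z_def[symmetric])
    then have "(k_scale s)\<^sup>2 * a * (inverse (k_scale s) / 2) = k_scale s * (a / 2)" for a
      by (simp add: power2_eq_square)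
    ultimately have "(k_scale has_real_derivative k_scale s * ((1 / z - 1 / x) / 2)) (at s)"
      by (simp only:)
    then show ?thesis by (simp add: diff_divide_distrib mult.commute)
  qed
  have A: "1 / A1sq s = 1 + 1 / s - 1 / x"
  proof -
    have "z * y = s * x + x - s" by (simp add: x_def y_def z_def field_simps)
    then show ?thesis using s pos
      unfolding A1sq_def x_def[symmetric] y_def[symmetric] z_def[symmetric] by (simp add: field_simps)
  qed
  have y: "3 * y / (2 * w * x) = (1/2) / w + 1 / x"
  proof -
    have "3 * y = x + 2 * w" by (simp add: x_def y_def w_def)
    then show ?thesis using pos by (simp add: field_simps)
  qed
  have "((\<lambda>s. k_scale s * G s * inverse s) has_real_derivative
      (k_scale s * ((1/2) / z - (1/2) / x) * G s + (G s * (1 - F) / A1sq s - 3 * G s * y / (2 * w * x)) * k_scale s) * inverse s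
      + - (inverse s * 1 * inverse s) * (k_scale s * G s)) (at s)"
    using s unfolding x_def w_def y_def z_def
    by (intro DERIV_mult DERIV_inverse' DERIV_ident P[unfolded x_def z_def] G_deriv[OF s, folded F_def G_def]) simp
  moreover have "G s * (1 - F) / A1sq s - 3 * G s * y / (2 * w * x)
      = G s * ((1 / A1sq s) - F / A1sq s - 3 * y / (2 * w * x))"
    by (simp add: right_diff_distrib diff_divide_distrib mult_ac)
  moreover have "(p * ((1/2) / z - (1/2) / x) * q + q * (1 + 1 / s - 1 / x - e - ((1/2) / w + 1 / x)) * p) * inverse s
      + - (inverse s * 1 * inverse s) * (p * q) = - (p * q * inverse s) * (e - 1 + damping s)" for p q e
    unfolding damping_def x_def[symmetric] w_def[symmetric] z_def[symmetric]
    unfolding divide_inverse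
    by (simp add: algebra_simps)
  ultimately have "((\<lambda>s. k_scale s * G s * inverse s) has_real_derivative
     - (k_scale s * G s * inverse s) * (F / A1sq s - 1 + damping s)) (at s)"
    by (simp only: A y)
  moreover have "\<forall>\<^sub>F s in nhds s. conn_k s = k_scale s * G s * inverse s"
    using eventually_nhds_pos[OF s] by (rule eventually_mono) (simp add: conn_k_def G_def divide_inverse)
  ultimately show ?thesis using s by (simp add: DERIV_cong_ev[OF refl] conn_k_def conn_x_def G_def F_def divide_inverse)
qed


section \<open>Initial values at \<open>s = 0\<close>\<close>

lemma tau_div_sqrt: "((\<lambda>s. tau s / sqrt s) \<longlongrightarrow> 2) (at_right 0)"
  using t_of_r_asymp by (simp add: tau_def)

lemma tau_at_right: "filterlim tau (at_right 0) (at_right 0)"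
proof -
  have "((\<lambda>s. tau s / sqrt s * sqrt s) \<longlongrightarrow> 2 * sqrt 0) (at_right 0)"
    by (intro tendsto_mult tau_div_sqrt tendsto_real_sqrt tendsto_ident_at)
  moreover have "\<forall>\<^sub>F s in at_right 0. tau s / sqrt s * sqrt s = tau s"
    by (rule eventually_at_rightI[of 0 1]) auto
  ultimately have "(tau \<longlongrightarrow> 0) (at_right 0)"
    using Lim_transform_eventually by fastforce
  then show ?thesis
    unfolding filterlim_at
    by (intro conjI eventually_at_rightI[of 0 1]) (use tau_pos in \<open>force simp: less_imp_neq[symmetric]\<close>)+
qed

lemma slope_at_tau:
  assumes "(\<lambda>t. h t - c * t) \<in> O[at_right 0](\<lambda>t. t ^ 3)"
  shows "((\<lambda>s. h (tau s) / tau s) \<longlongrightarrow> c) (at_right 0)"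
proof -
  have "(\<lambda>t. t ^ 3) \<in> o[at_right 0](\<lambda>t. t :: real)"
    by real_asymp
  with assms have "(\<lambda>t. h t - c * t) \<in> o[at_right 0](\<lambda>t. t)"
    by (rule landau_o.big_small_trans)
  then have "((\<lambda>t. (h t - c * t) / t + c) \<longlongrightarrow> 0 + c) (at_right 0)"
    by (intro tendsto_add tendsto_const smalloD_tendsto)
  moreover have "\<forall>\<^sub>F t in at_right 0. (h t - c * t) / t + c = h t / t"
    by (rule eventually_at_rightI[of 0 1]) (auto simp: diff_divide_distrib)
  ultimately have "((\<lambda>t. h t / t) \<longlongrightarrow> c) (at_right 0)"
    using Lim_transform_eventually by fastforce
  from filterlim_compose[OF this tau_at_right] show ?thesis .
qed

text \<open>\<open>F / A1sq\<close> equals \<open>f / cA 1\<close>, where \<open>f\<close> behaves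
  like \<open>2 * f1 * sqrt s\<close> and \<open>cA 1\<close> like \<open>sqrt s\<close>.\<close>

lemma conn_x_at_0: "(conn_x \<longlongrightarrow> conn_x 0) (at_right 0)"
proof -
  have "((\<lambda>s. f (tau s) / tau s * (tau s / sqrt s) / sqrt ((s + 9/2) / ((s + 3/2) * (s + 3))) - 1)
      \<longlongrightarrow> f1 * 2 / sqrt ((0 + 9/2) / ((0 + 3/2) * (0 + 3))) - 1) (at_right 0)"
    by (intro tendsto_intros slope_at_tau[OF f_init] tau_div_sqrt tendsto_ident_at) auto
  moreover have "\<forall>\<^sub>F s in at_right 0. f (tau s) / tau s * (tau s / sqrt s) / sqrt ((s + 9/2) / ((s + 3/2) * (s + 3))) - 1 = conn_x s"
  proof (rule eventually_at_rightI[of 0 1])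
    fix s :: real assume "s \<in> {0<..<1}"
    then have s: "s > 0" by simp
    define a where "a = sqrt (A1sq s)"
    have a: "a > 0" "A1sq s = a * a" using A1sq_pos[OF s] by (simp_all add: a_def)
    have "A1sq s = s * ((s + 9/2) / ((s + 3/2) * (s + 3)))" by (simp add: A1sq_def)
    then have "sqrt s * sqrt ((s + 9/2) / ((s + 3/2) * (s + 3))) = a"
      by (simp only: a_def real_sqrt_mult)
    moreover have "conn_x s = f (tau s) / a - 1"
      using coeffs_at_t_of_r(1)[OF s] a s by (simp add: conn_x_def tau_def a_def[symmetric])
    moreover have "f (tau s) / tau s * (tau s / sqrt s) / e = f (tau s) / (sqrt s * e)" for e
      using tau_pos[OF s] by simp
    ultimately show "f (tau s) / tau s * (tau s / sqrt s) / sqrt ((s + 9/2) / ((s + 3/2) * (s + 3))) - 1 = conn_x s"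
      by (simp only:)
  qed simp
  ultimately have "(conn_x \<longlongrightarrow> f1 * 2 / sqrt ((0 + 9/2) / ((0 + 3/2) * (0 + 3))) - 1) (at_right 0)"
    by (rule Lim_transform_eventually)
  then show ?thesis by (simp add: conn_x_def mult.commute)
qed

text \<open>Both \<open>cA 2\<close> and \<open>g\<close> are of order \<open>sqrt s\<close>, which
  compensates the division by \<open>s\<close>; the factor 2 comes from \<open>tau s\<close> being
  asymptotic to \<open>2 * sqrt s\<close>.\<close>

lemma conn_k_at_0: "(conn_k \<longlongrightarrow> conn_k 0) (at_right 0)"
proof -
  have "((\<lambda>s. k_scale s * (sqrt ((s + 3) / 3) * (g (tau s) / tau s * (tau s / sqrt s))))
      \<longlongrightarrow> sqrt (3 * (0 + 3/2) / (0 + 9/2)) * (sqrt ((0 + 3) / 3) * (g1 * 2))) (at_right 0)"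
    unfolding k_scale_def
    by (intro tendsto_intros slope_at_tau[OF g_init] tau_div_sqrt tendsto_ident_at) auto
  moreover have "\<forall>\<^sub>F s in at_right 0. k_scale s * (sqrt ((s + 3) / 3) * (g (tau s) / tau s * (tau s / sqrt s))) = conn_k s"
  proof (rule eventually_at_rightI[of 0 1])
    fix s :: real assume "s \<in> {0<..<1}"
    then have s: "s > 0" by simp
    have "s * (s + 3) / 3 = s * ((s + 3) / 3)" by simp
    then have "cA 2 (tau s) = sqrt s * sqrt ((s + 3) / 3)"
      using coeffs_at_t_of_r(2)[OF s] by (simp only: tau_def real_sqrt_mult)
    moreover have "sqrt s * e * h / s = e * (h / sqrt s)" for e h
      using s by (simp add: field_simps flip: power2_eq_square)
    moreover have "g (tau s) / tau s * (tau s / sqrt s) = g (tau s) / sqrt s"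
      using tau_pos[OF s] by simp
    ultimately show "k_scale s * (sqrt ((s + 3) / 3) * (g (tau s) / tau s * (tau s / sqrt s))) = conn_k s"
      using s by (simp only: conn_k_def times_divide_eq_right[symmetric, of "k_scale s"]) simp
  qed simp
  ultimately have "(conn_k \<longlongrightarrow> sqrt (3 * (0 + 3/2) / (0 + 9/2)) * (sqrt ((0 + 3) / 3) * (g1 * 2))) (at_right 0)"
    by (rule Lim_transform_eventually)
  then show ?thesis by (simp add: conn_k_def mult.commute)
qed

sublocale planar_system damping conn_x conn_k
proof
  show "continuous_on {0..} damping" unfolding damping_def by (intro continuous_intros) auto
  show "continuous_on {0..} conn_x" by (rule continuous_on_from_0) (use conn_x_deriv conn_x_at_0 in auto)
  show "continuous_on {0..} conn_k" by (rule continuous_on_from_0) (use conn_k_deriv conn_k_at_0 in auto)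
qed (use damping_nonneg conn_x_deriv conn_k_deriv g1_pos f1_large in \<open>auto simp: conn_k_def conn_x_def\<close>)

section \<open>Limits as \<open>t\<close> tends to infinity\<close>

lemma conn_tendsto: "((\<lambda>t. cA 1 t * f t) \<longlongrightarrow> 1 + x_inf) at_top"
proof -
  have "(A1sq \<longlongrightarrow> 1) at_top" unfolding A1sq_def by real_asymp
  then have "((\<lambda>s. A1sq s * (1 + conn_x s)) \<longlongrightarrow> 1 * (1 + x_inf)) at_top"
    by (intro tendsto_intros x_tendsto)
  from filterlim_compose[OF this r_of_t_at_top]
  have "((\<lambda>t. A1sq (r_of_t t - 9/4) * (1 + conn_x (r_of_t t - 9/4))) \<longlongrightarrow> 1 + x_inf) at_top" by simp
  moreover have "\<forall>\<^sub>F t in at_top. A1sq (r_of_t t - 9/4) * (1 + conn_x (r_of_t t - 9/4)) = cA 1 t * f t"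
  proof (rule eventually_mono[OF eventually_gt_at_top[of 0]])
    fix t :: real assume t: "t > 0"
    then obtain s where s: "s \<ge> 0" "t_of_r (9/4 + s) = t" using t_of_r_surj[of t] by auto
    with t t_of_r_0 have "s > 0" by (cases "s = 0") auto
    moreover have "r_of_t t - 9/4 = s" using r_of_t_of_r[OF s(1)] s(2) by simp
    ultimately show "A1sq (r_of_t t - 9/4) * (1 + conn_x (r_of_t t - 9/4)) = cA 1 t * f t"
      using A1sq_pos[of s] s(2) by (simp add: conn_x_def tau_def)
  qed
  ultimately show ?thesis by (rule Lim_transform_eventually)
qed

lemma holonomy_tendsto:
  "((\<lambda>t. holonomy (inv_conn f g) (circ t)) \<longlongrightarrow> exp ((2 * pi * (1 + x_inf)) *\<^sub>R T 1)) at_top"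
proof -
  have e: "exp (x *\<^sub>R T 1) = cos x *\<^sub>R 1 + sin x *\<^sub>R T 1" for x
    unfolding exp_T1 by (simp add: quat_eq_iff T_sel)
  show ?thesis
    unfolding holonomy_circ e mult.assoc
    by (intro tendsto_intros conn_tendsto)
qed

lemma Hol_infty_eq: "Hol_infty (inv_conn f g) = exp ((2 * pi * (1 + x_inf)) *\<^sub>R T 1)"
  unfolding Hol_infty_def by (rule tendsto_Lim[OF _ holonomy_tendsto]) simp

end

section \<open>Dependence of the limit on \<open>f1\<close> and surjectivity onto the circle\<close>

theorem corollary3:
  fixes g1 :: real
    and f g :: "real \<Rightarrow> real \<Rightarrow> real"
  assumes g1: "g1 > 0"
    and instanton: "\<And>f1. f1 > 1/2 + g1 \<Longrightarrow> G2_instanton (inv_conn (f f1) (g f1))"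
    and extends: "\<And>f1. f1 > 1/2 + g1 \<Longrightarrow> extends_smoothly_on_P1 (inv_conn (f f1) (g f1))"
    and f_init: "\<And>f1. f1 > 1/2 + g1 \<Longrightarrow> (\<lambda>t. f f1 t - f1 * t) \<in> O[at_right 0](\<lambda>t. t ^ 3)"
    and g_init: "\<And>f1. f1 > 1/2 + g1 \<Longrightarrow> (\<lambda>t. g f1 t - g1 * t) \<in> O[at_right 0](\<lambda>t. t ^ 3)"
  shows "(\<forall>f1 > 1/2 + g1.
            ((\<lambda>t. holonomy (inv_conn (f f1) (g f1)) (circ t))
               \<longlongrightarrow> Hol_infty (inv_conn (f f1) (g f1))) at_top)
       \<and> (\<lambda>f1. Hol_infty (inv_conn (f f1) (g f1))) ` {1/2 + g1 <..} = U1"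
proof -
  have inst: "instanton (f f1) (g f1) f1 g1" if "f1 > 1/2 + g1" for f1
    using that assms by unfold_locales auto
  define X where "X f1 = planar_system.x_inf (instanton.conn_x (f f1) f1)" for f1
  have tendsto: "((\<lambda>t. holonomy (inv_conn (f f1) (g f1)) (circ t))
      \<longlongrightarrow> Hol_infty (inv_conn (f f1) (g f1))) at_top"
    and Hol: "Hol_infty (inv_conn (f f1) (g f1)) = exp ((2 * pi * (1 + X f1)) *\<^sub>R T 1)"
    if "f1 > 1/2 + g1" for f1
  proof -
    interpret instanton "f f1" "g f1" f1 g1 by (rule inst[OF that])
    show "Hol_infty (inv_conn (f f1) (g f1)) = exp ((2 * pi * (1 + X f1)) *\<^sub>R T 1)"
      by (simp add: Hol_infty_eq X_def)
    show "((\<lambda>t. holonomy (inv_conn (f f1) (g f1)) (circ t))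
      \<longlongrightarrow> Hol_infty (inv_conn (f f1) (g f1))) at_top"
      unfolding Hol_infty_eq by (rule holonomy_tendsto)
  qed
  have X_lower: "X f1 \<ge> 2 * f1 - 1 - 2 * g1" if "f1 > 1/2 + g1" for f1
  proof -
    interpret instanton "f f1" "g f1" f1 g1 by (rule inst[OF that])
    \<comment> \<open>An instance of \<open>(a - b)\<^sup>2 <= a\<^sup>2 - b\<^sup>2\<close> for
      \<open>0 <= b <= a\<close>; it gives a lower bound that is linear in
      \<open>f1\<close>.\<close>
    have "(2 * f1 - 1 - 2 * g1)\<^sup>2 \<le> (conn_x 0)\<^sup>2 - (conn_k 0)\<^sup>2"
      using mult_nonneg_nonneg[of g1 "2 * f1 - 1 - 2 * g1"] that g1
      by (simp add: conn_x_def conn_k_def power2_eq_square algebra_simps)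
    then show ?thesis unfolding X_def using that by (intro x_inf_lower) simp_all
  qed
  \<comment> \<open>From here on the energy \<open>(2 * f1 - 1)\<^sup>2 - (2 * g1)\<^sup>2\<close>
    is at least \<open>1\<close>, so the comparison applies with \<open>c = 1\<close> and gives one
    Lipschitz constant for the whole half-line \<open>{b..}\<close>.\<close>
  define b where "b = 1 + g1"
  have b: "b > 1/2 + g1" by (simp add: b_def)
  define K where "K = exp ((2 * g1)\<^sup>2 / (2 * 1\<^sup>2)) * 2"
  have X_Lipschitz: "\<bar>X u - X v\<bar> \<le> K * \<bar>u - v\<bar>" if "b \<le> v" "v < u" for u v
  proof -
    have uv: "v > 1/2 + g1" "u > 1/2 + g1" using that b by simp_all
    interpret v: instanton "f v" "g v" v g1 by (rule inst[OF uv(1)])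
    interpret u: instanton "f u" "g u" u g1 by (rule inst[OF uv(2)])
    interpret planar_pair damping v.conn_x v.conn_k u.conn_x u.conn_k
      using that by unfold_locales (simp_all add: v.conn_x_def u.conn_x_def v.conn_k_def u.conn_k_def)
    have "(1 + 2 * g1)\<^sup>2 \<le> (2 * v - 1)\<^sup>2"
      using that g1 by (intro power_mono) (auto simp: b_def)
    then have c: "1\<^sup>2 \<le> (v.conn_x 0)\<^sup>2 - (v.conn_k 0)\<^sup>2"
      using g1 by (simp add: v.conn_x_def v.conn_k_def power2_sum power_mult_distrib)
    show ?thesis
      using x_inf_Lipschitz[OF zero_less_one c] that
      by (simp add: X_def K_def v.conn_x_def u.conn_x_def v.conn_k_def right_diff_distrib mult.assoc)
  qed
  have "K-lipschitz_on {b..} X"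
  proof (rule lipschitz_onI)
    fix u v assume uv: "u \<in> {b..}" "v \<in> {b..}"
    consider "u < v" | "u = v" | "v < u" by linarith
    then show "dist (X u) (X v) \<le> K * dist u v"
      using X_Lipschitz[of u v] X_Lipschitz[of v u] uv by cases (auto simp: dist_real_def abs_minus_commute)
  qed (simp add: K_def)
  then have cont: "continuous_on {b..} X" by (rule lipschitz_on_continuous_on)
  have surj: "\<exists>f1 > 1/2 + g1. X f1 = y" if y: "y \<ge> X b" for y
  proof -
    \<comment> \<open>Large enough for the linear lower bound on \<open>X d\<close> to exceed
      \<open>y\<close>, so the intermediate value theorem applies on \<open>{b..d}\<close>.\<close>
    define d where "d = b + \<bar>y\<bar> + 1 + g1"
    have "d \<ge> b" using g1 by (simp add: d_def)
    moreover have "X d \<ge> y"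
    proof -
      have "d > 1/2 + g1" using b \<open>d \<ge> b\<close> by simp
      moreover have "2 * d - 1 - 2 * g1 \<ge> y" using g1 abs_ge_self[of y] by (simp add: d_def b_def)
      ultimately show ?thesis using X_lower[of d] by simp
    qed
    ultimately obtain z where "b \<le> z" "X z = y"
      using IVT'[of X b y d] y continuous_on_subset[OF cont, of "{b..d}"] by auto
    with b show ?thesis by (intro exI[of _ z]) auto
  qed
  have "(\<lambda>f1. Hol_infty (inv_conn (f f1) (g f1))) ` {1/2 + g1 <..} = U1"
  proof (intro equalityI subsetI)
    fix h assume "h \<in> (\<lambda>f1. Hol_infty (inv_conn (f f1) (g f1))) ` {1/2 + g1 <..}"
    then show "h \<in> U1" using Hol by (auto simp: U1_def)
  next
    fix h assume "h \<in> U1"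
    then obtain \<theta> where h: "h = exp (\<theta> *\<^sub>R T 1)" by (auto simp: U1_def)
    \<comment> \<open>Adding \<open>n\<close> full turns to \<theta> leaves the group element
      unchanged and moves the required value of \<open>X\<close> above \<open>X b\<close>, into the
      range already covered.\<close>
    obtain n :: nat where n: "real n \<ge> X b + 1 - \<theta> / (2 * pi)"
      using real_arch_simple by blast
    obtain f1 where f1: "f1 > 1/2 + g1" "X f1 = \<theta> / (2 * pi) + n - 1"
      using surj[of "\<theta> / (2 * pi) + n - 1"] n by auto
    have "2 * pi * (1 + X f1) = \<theta> + 2 * real n * pi"
      unfolding f1(2) by (simp add: field_simps)
    then have "Hol_infty (inv_conn (f f1) (g f1)) = h"
      unfolding Hol[OF f1(1)] h exp_T1 by (simp add: sin_add cos_add)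
    with f1(1) show "h \<in> (\<lambda>f1. Hol_infty (inv_conn (f f1) (g f1))) ` {1/2 + g1 <..}" by force
  qed
  with tendsto show ?thesis by blast
qed

end
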